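(* For all fixed $m,n\in\mathbb N$ with $m\ge2$, $$\lim_{p\to\infty}C_{p,m,n}=1.$$
   Context: $\mathbb U$ is the open unit disc in $\mathbb C$, $\mathbb T$ the unit circle, $\mathbb U^n$ the unit polydisc, and $dm_n$ is normalized Haar measure on $\mathbb T^n$. A complex-valued $f\in C^2(\mathbb U^n)$ is pluriharmonic if $\partial^2 f/\partial z_j\partial\overline z_k=0$ for all $1\le j,k\le n$. For $0<p<\infty$, $h^p(\mathbb U^n)$ is the set of complex-valued pluriharmonic $f$ on $\mathbb U^n$ with $$\|f\|_{h^p(\mathbb U^n)}=\sup_{0<r<1}\Big(\int_{\mathbb T^n}|f(r\omega)|^p\,dm_n(\omega)\Big)^{1/p}<\infty.$$ For an integer $m\ge2$, $$d\mu_{\mathbf{m-2}}(z)=\frac{(m-1)^n}{\pi^n}\prod_{k=1}^n(1-|z_k|^2)^{m-2}\,dx_k\,dy_k,\qquad z_k=x_k+iy_k,$$ and for $0<q<\infty$, $\|f\|_{b^q_{\mathbf{m-2}}(\mathbb U^n)}=\big(\int_{\mathbb U^n}|f|^q\,d\mu_{\mathbf{m-2}}\big)^{1/q}$. For real $1<p<\infty$, $C_{p,m,n}$ denotes the best (smallest) constant $C$ such that $\|f\|_{b^{mp}_{\mathbf{m-2}}(\mathbb U^n)}\le C\|f\|_{h^p(\mathbb U^n)}$ for all $f\in h^p(\mathbb U^n)$. *)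

theory Defs
  imports "HOL-Analysis.Analysis"
begin

definition polydisc :: "(complex ^ 'n) set" where
  "polydisc = {z. \<forall>k. norm (z $ k) < 1}"

definition torus :: "(complex ^ 'n) set" where
  "torus = {z. \<forall>k. norm (z $ k) = 1}"

(* Twice continuously real differentiable; meant for open S. *)
definition C2_on :: "'a::real_normed_vector set \<Rightarrow> ('a \<Rightarrow> 'b::real_normed_vector) \<Rightarrow> bool" where
  "C2_on S f \<longleftrightarrow>
     (\<forall>x\<in>S. f differentiable (at x)) \<and>
     (\<forall>v. \<forall>x\<in>S. (\<lambda>y. frechet_derivative f (at y) v) differentiable (at x)) \<and>
     (\<forall>v w. continuous_on S
        (\<lambda>x. frechet_derivative (\<lambda>y. frechet_derivative f (at y) v) (at x) w))"

(* The Wirtinger derivatives (d/dx_j - i d/dy_j)/2 and (d/dx_j + i d/dy_j)/2; the real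
   partial derivatives are Frechet derivatives along axis j 1 and axis j \<i>. *)
definition wirtinger :: "'n::finite \<Rightarrow> (complex ^ 'n \<Rightarrow> complex) \<Rightarrow> complex ^ 'n \<Rightarrow> complex" where
  "wirtinger j f z =
     (frechet_derivative f (at z) (axis j 1) - \<i> * frechet_derivative f (at z) (axis j \<i>)) / 2"

definition wirtinger_bar :: "'n::finite \<Rightarrow> (complex ^ 'n \<Rightarrow> complex) \<Rightarrow> complex ^ 'n \<Rightarrow> complex" where
  "wirtinger_bar j f z =
     (frechet_derivative f (at z) (axis j 1) + \<i> * frechet_derivative f (at z) (axis j \<i>)) / 2"

(* Functions on the polydisc are total functions whose values elsewhere are irrelevant. *)
definition pluriharmonic :: "(complex ^ 'n::finite \<Rightarrow> complex) \<Rightarrow> bool" where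
  "pluriharmonic f \<longleftrightarrow>
     C2_on polydisc f \<and> (\<forall>j k. \<forall>z\<in>polydisc. wirtinger j (wirtinger_bar k f) z = 0)"

(* Normalized Haar measure on the torus, as the image of the normalized Lebesgue measure on
   the cube [0, 2 pi]^n under theta |-> (exp (i theta_1), ..., exp (i theta_n)). *)
definition haar_torus :: "(complex ^ 'n::finite) measure" where
  "haar_torus =
     distr (uniform_measure lborel (cbox 0 (\<chi> k. 2 * pi) :: (real ^ 'n) set))
       (restrict_space borel torus) (\<lambda>\<theta>. \<chi> k. cis (\<theta> $ k))"

lemma emeasure_haar_torus: "emeasure (haar_torus :: (complex ^ 'n::finite) measure) torus = 1"
proof -
  let ?Q = "cbox 0 (\<chi> k. 2 * pi) :: (real ^ 'n) set"
  have "continuous_on UNIV (\<lambda>\<theta> :: real ^ 'n. (\<chi> k. cis (\<theta> $ k)) :: complex ^ 'n)"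
    by (intro continuous_intros)
  then have "(\<lambda>\<theta>. \<chi> k. cis (\<theta> $ k)) \<in> borel \<rightarrow>\<^sub>M (restrict_space borel torus :: (complex ^ 'n) measure)"
    by (intro measurable_restrict_space2 borel_measurable_continuous_onI) (auto simp: torus_def)
  then have meas: "(\<lambda>\<theta>. \<chi> k. cis (\<theta> $ k)) \<in> uniform_measure lborel ?Q
      \<rightarrow>\<^sub>M (restrict_space borel torus :: (complex ^ 'n) measure)"
    by (simp cong: measurable_cong_sets)
  have pos: "((\<chi> k. 2 * pi) :: real ^ 'n) \<bullet> b > 0" if "b \<in> Basis" for b
    using that by (auto simp: Basis_vec_def inner_axis)
  have "emeasure lborel ?Q = ennreal (\<Prod>b\<in>Basis. ((\<chi> k. 2 * pi) :: real ^ 'n) \<bullet> b)"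
    using pos by (simp add: emeasure_lborel_cbox_eq less_imp_le)
  moreover have "(\<Prod>b\<in>Basis. ((\<chi> k. 2 * pi) :: real ^ 'n) \<bullet> b) > 0"
    using pos by (rule prod_pos)
  ultimately have "emeasure lborel ?Q \<noteq> 0" "emeasure lborel ?Q < \<infinity>"
    by (metis ennreal_eq_0_iff not_le, metis ennreal_less_top infinity_ennreal_def)
  then have "emeasure (uniform_measure lborel ?Q) UNIV = 1"
    by (simp add: emeasure_uniform_measure ennreal_divide_self)
  moreover have "torus \<in> sets (restrict_space borel torus :: (complex ^ 'n) measure)"
    by (metis sets.top space_restrict_space Int_UNIV_right space_borel)
  moreover have "(\<lambda>\<theta>. \<chi> k. cis (\<theta> $ k)) -` torus = (UNIV :: (real ^ 'n) set)"
    by (auto simp: torus_def)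
  ultimately show ?thesis
    by (simp add: haar_torus_def emeasure_distr[OF meas])
qed

(* The measure mu with weight exponent m - 2; meant for m \<ge> 2.  Here lborel is the product
   of the planar measures dx_k dy_k. *)
definition bergman_measure :: "nat \<Rightarrow> (complex ^ 'n::finite) measure" where
  "bergman_measure m =
     density (restrict_space lborel polydisc)
       (\<lambda>z. ennreal ((real m - 1) ^ CARD('n) / pi ^ CARD('n) *
                      (\<Prod>k\<in>UNIV. (1 - (norm (z $ k))\<^sup>2) ^ (m - 2))))"

(* Real powers on [0, \<infinity>]; meant for a > 0. *)
definition ennreal_powr :: "ennreal \<Rightarrow> real \<Rightarrow> ennreal" where
  "ennreal_powr x a = (if x = \<infinity> then \<infinity> else ennreal (enn2real x powr a))"

(* The following norms take values in [0, \<infinity>], the value \<infinity> meaning that the integral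
   (or the supremum of integrals) diverges. *)
definition Lp_norm :: "real \<Rightarrow> 'a measure \<Rightarrow> ('a \<Rightarrow> complex) \<Rightarrow> ennreal" where
  "Lp_norm p M f = ennreal_powr (\<integral>\<^sup>+ x. ennreal (norm (f x) powr p) \<partial>M) (1 / p)"

definition hardy_norm :: "real \<Rightarrow> (complex ^ 'n::finite \<Rightarrow> complex) \<Rightarrow> ennreal" where
  "hardy_norm p f = (SUP r\<in>{0<..<1}. Lp_norm p haar_torus (\<lambda>\<omega>. f (r *\<^sub>R \<omega>)))"

definition hardy_space :: "real \<Rightarrow> (complex ^ 'n::finite \<Rightarrow> complex) set" where
  "hardy_space p = {f. pluriharmonic f \<and> hardy_norm p f < \<infinity>}"

definition bergman_norm :: "nat \<Rightarrow> real \<Rightarrow> (complex ^ 'n::finite \<Rightarrow> complex) \<Rightarrow> ennreal" where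
  "bergman_norm m q f = Lp_norm q (bergman_measure m) f"

definition admissible_constants :: "'n::finite itself \<Rightarrow> real \<Rightarrow> nat \<Rightarrow> ennreal set" where
  "admissible_constants _ p m =
     {C. \<forall>f \<in> (hardy_space p :: (complex ^ 'n \<Rightarrow> complex) set).
           bergman_norm m (real m * p) f \<le> C * hardy_norm p f}"

(* The infimum is taken in [0, \<infinity>], so it is \<infinity> if no finite constant is admissible.
   It is a minimum whenever it is finite, by the lemma below. *)
definition best_constant :: "'n::finite itself \<Rightarrow> real \<Rightarrow> nat \<Rightarrow> ennreal" where
  "best_constant N p m = Inf (admissible_constants N p m)"

lemma best_constant_admissible:
  assumes "best_constant N p m < \<infinity>"
  shows "best_constant N p m \<in> admissible_constants N p m"
proof -
  let ?A = "admissible_constants N p m"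
  have ne: "?A \<noteq> {}"
    using assms by (auto simp: best_constant_def)
  have "bergman_norm m (real m * p) f \<le> best_constant N p m * hardy_norm p f"
    if f: "f \<in> hardy_space p" for f :: "complex ^ 'a \<Rightarrow> complex"
  proof -
    have fin: "hardy_norm p f \<noteq> \<infinity>"
      using f by (auto simp: hardy_space_def)
    have "bergman_norm m (real m * p) f \<le> (INF C\<in>?A. C * hardy_norm p f)"
      using f by (intro INF_greatest) (auto simp: admissible_constants_def)
    also have "\<dots> = Inf ?A * hardy_norm p f"
    proof -
      have "continuous_on UNIV (\<lambda>C. hardy_norm p f * C)"
        using fin by (intro ennreal_continuous_on_cmult continuous_on_id) (auto simp: less_top)
      then have "continuous (at_right (Inf ?A)) (\<lambda>C. hardy_norm p f * C)"
        by (auto simp: continuous_on_eq_continuous_at intro: continuous_at_imp_continuous_at_within)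
      then have "hardy_norm p f * Inf ?A = (INF C\<in>?A. hardy_norm p f * C)"
        using ne by (intro continuous_at_Inf_mono) (auto simp: mono_def intro: mult_left_mono)
      then show ?thesis by (simp add: mult.commute)
    qed
    finally show ?thesis by (simp add: best_constant_def)
  qed
  then show ?thesis by (auto simp: admissible_constants_def)
qed

end

theory Submission
  imports
    Defs
    "HOL-Complex_Analysis.Cauchy_Integral_Formula"
    "HOL-Real_Asymp.Real_Asymp"
begin

text \<open>
  The function \<open>1\<close> shows that the best constant is at least \<open>1\<close>, because the Bergman measure has
  total mass \<open>1\<close>. For an upper bound, let \<open>p \<ge> 2\<close> and \<open>u = \<bar>f\<bar> powr (p / 2)\<close> for a dilated
  pluriharmonic \<open>f\<close>. The Poisson formula in each variable and Jensen's inequality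
  give \<open>u \<le> P[u]\<close> on the polydisc. The Poisson extension \<open>P\<close> is bounded from \<open>L\<^sup>2\<close> of the torus
  to \<open>L\<^sup>2\<^sup>m\<close> of the Bergman measure with some constant that depends on \<open>m\<close> and \<open>n\<close> only. Hence
  \<open>\<integral> \<bar>f\<bar> powr (m p) \<le> c (\<integral> \<bar>f\<bar> powr p) ^ m\<close> with \<open>c\<close> independent of \<open>p\<close>, and the best constant is at
  most \<open>c powr (1 / (m p))\<close>, which tends to \<open>1\<close>.

  Boundedness of \<open>P\<close> is proved by the \<open>T T*\<close> method. The kernel of \<open>P P*\<close> is at most the product of
  \<open>K = 2 / \<bar>1 - z cnj \<zeta>\<bar>\<close> over the variables, and Young's inequality reduces the claim to the \<open>L\<^sup>2\<close>
  boundedness of the kernel \<open>K ^ m\<close>, which is the modulus of the weighted Bergman kernel up to a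
  constant. This follows from the Schur test with the weight \<open>(1 - \<bar>z\<bar>\<^sup>2) powr (-1/2)\<close> in each variable.
\<close>

section \<open>Lebesgue measure\<close>

lemma nn_integral_lborel_translation:
  fixes c :: "'a::euclidean_space"
  assumes [measurable]: "f \<in> borel_measurable borel"
  shows "(\<integral>\<^sup>+x. f (c + x) \<partial>lborel) = (\<integral>\<^sup>+x. f x \<partial>lborel)"
  by (subst lborel_distr_plus[of c, symmetric], subst nn_integral_distr) auto

(* Weil's uniqueness argument: integrate 1_A(x + y) 1_B(y), B the unit ball, in both orders. *)
lemma lborel_distr_orthogonal:
  fixes T :: "'a::euclidean_space \<Rightarrow> 'a"
  assumes T: "orthogonal_transformation T"
  shows "distr lborel borel T = lborel"
proof (rule measure_eqI)
  fix A assume "A \<in> sets (distr lborel borel T)"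
  then have A[measurable]: "A \<in> sets borel" by simp
  let ?I = "indicator :: 'a set \<Rightarrow> 'a \<Rightarrow> ennreal"
  define B where "B = ball (0::'a) 1"
  have [measurable]: "B \<in> sets borel" by (simp add: B_def)
  have lin: "linear T" and nT: "\<And>x. norm (T x) = norm x"
    using T by (auto simp: orthogonal_transformation)
  have [measurable]: "T \<in> borel_measurable borel"
    using lin by (intro borel_measurable_continuous_onI linear_continuous_on)
      (simp add: linear_conv_bounded_linear)
  have surj: "\<exists>x. T x = y" for y
    using orthogonal_transformation_surj[OF T] by (metis surjD)
  \<comment> \<open>Since \<open>T\<close> is onto, translating by \<open>y\<close> after
    \<open>T\<close> is the same as applying \<open>T\<close> after translating by a preimage of
    \<open>y\<close>. So the integral of \<open>f o T\<close> is again translation invariant in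
    \<open>f\<close>.\<close>
  have tr: "(\<integral>\<^sup>+x. f (T x + y) \<partial>lborel) = (\<integral>\<^sup>+x. f (T x) \<partial>lborel)"
    if [measurable]: "f \<in> borel_measurable borel" for f :: "'a \<Rightarrow> ennreal" and y
  proof -
    obtain c where c: "T c = y" using surj by blast
    have "(\<integral>\<^sup>+x. f (T x + y) \<partial>lborel) = (\<integral>\<^sup>+x. f (T (c + x)) \<partial>lborel)"
      by (simp add: linear_add[OF lin] c add.commute)
    also have "\<dots> = (\<integral>\<^sup>+x. f (T x) \<partial>lborel)"
      by (rule nn_integral_lborel_translation[of "\<lambda>x. f (T x)"]) simp
    finally show ?thesis .
  qed
  \<comment> \<open>The volume of \<open>B\<close> is cancelled at the end, which requires it to be
    neither \<open>0\<close> nor infinite.\<close>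
  have B0: "emeasure lborel B \<noteq> 0" "emeasure lborel B \<noteq> \<infinity>"
    using emeasure_lborel_ball_finite[of 0 1] content_ball_pos[of 1 "0::'a"]
    by (auto simp: measure_def B_def)
  have "(\<integral>\<^sup>+x. ?I A (T x) \<partial>lborel) * emeasure lborel B =
      (\<integral>\<^sup>+y. (\<integral>\<^sup>+x. ?I A (T x + y) * ?I B y \<partial>lborel) \<partial>lborel)"
    by (simp add: nn_integral_multc tr nn_integral_cmult_indicator)
  also have "\<dots> = (\<integral>\<^sup>+x. (\<integral>\<^sup>+y. ?I A (T x + y) * ?I B y \<partial>lborel) \<partial>lborel)"
    by (rule lborel_pair.Fubini') measurable
  also have "\<dots> = (\<integral>\<^sup>+x. (\<integral>\<^sup>+y. ?I A y * ?I B (y - T x) \<partial>lborel) \<partial>lborel)"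
  proof (rule nn_integral_cong)
    fix x
    show "(\<integral>\<^sup>+y. ?I A (T x + y) * ?I B y \<partial>lborel) = (\<integral>\<^sup>+y. ?I A y * ?I B (y - T x) \<partial>lborel)"
      using nn_integral_lborel_translation[of "\<lambda>y. ?I A y * ?I B (y - T x)" "T x"] by simp
  qed
  also have "\<dots> = (\<integral>\<^sup>+y. (\<integral>\<^sup>+x. ?I A y * ?I B (y - T x) \<partial>lborel) \<partial>lborel)"
    by (rule lborel_pair.Fubini') simp
  \<comment> \<open>The ball is symmetric and \<open>T\<close> preserves norms, so reflecting,
    translating and dropping \<open>T\<close> does not change its volume.\<close>
  also have "\<dots> = (\<integral>\<^sup>+y. ?I A y * emeasure lborel B \<partial>lborel)"
  proof (rule nn_integral_cong)
    fix y
    have "(\<integral>\<^sup>+x. ?I B (y - T x) \<partial>lborel) = (\<integral>\<^sup>+x. ?I B (T x + (- y)) \<partial>lborel)"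
      by (intro nn_integral_cong) (auto simp: indicator_def B_def norm_minus_commute)
    also have "\<dots> = (\<integral>\<^sup>+x. ?I B (T x) \<partial>lborel)" by (rule tr) simp
    also have "\<dots> = (\<integral>\<^sup>+x. ?I B x \<partial>lborel)"
      by (intro nn_integral_cong) (auto simp: indicator_def B_def nT)
    finally show "(\<integral>\<^sup>+x. ?I A y * ?I B (y - T x) \<partial>lborel) = ?I A y * emeasure lborel B"
      by (simp add: nn_integral_cmult)
  qed
  also have "\<dots> = emeasure lborel A * emeasure lborel B"
    by (simp add: nn_integral_multc)
  finally have "(\<integral>\<^sup>+x. ?I A (T x) \<partial>lborel) = emeasure lborel A"
    using B0 by (metis ennreal_mult_cancel_left mult.commute infinity_ennreal_def)
  moreover have "(\<integral>\<^sup>+x. ?I A (T x) \<partial>lborel) = emeasure (distr lborel borel T) A"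
    using nn_integral_distr[of T lborel borel "?I A"] by simp
  ultimately show "emeasure (distr lborel borel T) A = emeasure lborel A" by simp
qed simp

section \<open>Lebesgue measure on finite vectors as a product measure\<close>

lemma borel_measurable_vec_lambda:
  fixes g :: "'n::finite \<Rightarrow> 'b \<Rightarrow> 'a::euclidean_space"
  assumes [measurable]: "\<And>k. g k \<in> borel_measurable M"
  shows "(\<lambda>x. \<chi> k. g k x) \<in> borel_measurable M"
proof (rule borel_measurable_euclidean_space[THEN iffD2], rule ballI)
  fix b :: "'a ^ 'n" assume "b \<in> Basis"
  then obtain i c where b: "b = axis i c" by (auto simp: Basis_vec_def)
  show "(\<lambda>x. (\<chi> k. g k x) \<bullet> b) \<in> borel_measurable M"
    unfolding b inner_axis vec_lambda_beta by measurable
qed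

lemma measurable_vec_nth [measurable]: "(\<lambda>x::'a::euclidean_space ^ 'n::finite. x $ k) \<in> borel_measurable borel"
  by (intro borel_measurable_continuous_onI continuous_intros)

lemma measurable_vec_lambda_PiM [measurable]:
  "vec_lambda \<in> (Pi\<^sub>M UNIV (\<lambda>_::'n::finite. lborel :: 'a::euclidean_space measure)) \<rightarrow>\<^sub>M borel"
  using borel_measurable_vec_lambda[of "\<lambda>k x. x k" "Pi\<^sub>M UNIV (\<lambda>_::'n. lborel :: 'a measure)"] by simp

text \<open>Both measures give a box the same volume: a box is a product of coordinate boxes, and
  \<open>Basis\<close> is indexed by pairs of a coordinate and a basis vector of \<open>'a\<close>.
  On the product side integrals factor and coordinates can be handled one by one.\<close>

lemma lborel_vec:
  "(lborel :: ('a::euclidean_space ^ 'n) measure) =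
     distr (Pi\<^sub>M UNIV (\<lambda>_. lborel)) borel vec_lambda"
proof (rule lborel_eqI)
  interpret product_sigma_finite "\<lambda>_::'n. lborel :: 'a measure" by standard
  fix l u :: "'a ^ 'n" assume lu: "\<And>b. b \<in> Basis \<Longrightarrow> l \<bullet> b \<le> u \<bullet> b"
  have lu': "l $ i \<bullet> b \<le> u $ i \<bullet> b" if "b \<in> Basis" for i b
    using lu[of "axis i b"] that by (auto simp: Basis_vec_def inner_axis)
  have "emeasure (distr (Pi\<^sub>M UNIV (\<lambda>_. lborel)) borel vec_lambda) (box l u)
      = emeasure (Pi\<^sub>M UNIV (\<lambda>_::'n. lborel :: 'a measure)) (\<Pi>\<^sub>E i\<in>UNIV. box (l $ i) (u $ i))"
    by (subst emeasure_distr)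
      (auto intro!: arg_cong2[where f=emeasure]
        simp: space_PiM PiE_def Pi_def mem_box Basis_vec_def inner_axis)
  also have "\<dots> = (\<Prod>i\<in>UNIV. ennreal (\<Prod>b\<in>Basis. (u $ i - l $ i) \<bullet> b))"
    by (subst emeasure_PiM) (auto simp: emeasure_lborel_box_eq lu' intro!: prod.cong)
  also have "\<dots> = ennreal (\<Prod>i\<in>UNIV. \<Prod>b\<in>Basis. (u $ i - l $ i) \<bullet> b)"
    by (subst prod_ennreal) (auto intro!: prod_nonneg simp: lu' inner_diff_left)
  also have "(\<Prod>i\<in>UNIV. \<Prod>b\<in>Basis. (u $ i - l $ i) \<bullet> b) = (\<Prod>b\<in>Basis. (u - l) \<bullet> b)"
  proof -
    have inj: "inj_on (\<lambda>(i, b). axis i b :: 'a ^ 'n) (UNIV \<times> Basis)"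
      by (auto simp: inj_on_def axis_eq_axis)
    have "(Basis :: ('a ^ 'n) set) = (\<lambda>(i, b). axis i b) ` (UNIV \<times> Basis)"
      by (auto simp: Basis_vec_def)
    then have "(\<Prod>b\<in>Basis. (u - l) \<bullet> b)
        = (\<Prod>b\<in>(\<lambda>(i, b). axis i b :: 'a ^ 'n) ` (UNIV \<times> Basis). (u - l) \<bullet> b)" by simp
    also have "\<dots> = (\<Prod>(i, b)\<in>UNIV \<times> Basis. (u $ i - l $ i) \<bullet> b)"
      by (subst prod.reindex[OF inj]) (auto simp: inner_axis intro!: prod.cong)
    finally show ?thesis by (simp add: prod.cartesian_product)
  qed
  finally show "emeasure (distr (Pi\<^sub>M UNIV (\<lambda>_. lborel)) borel vec_lambda) (box l u)
      = (\<Prod>b\<in>Basis. (u - l) \<bullet> b)" .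
qed simp

section \<open>The Poisson kernel of the disc\<close>

definition poisson :: "complex \<Rightarrow> complex \<Rightarrow> real" where
  "poisson z w = (1 - (norm z)\<^sup>2) / (norm (w - z))\<^sup>2"

lemma poisson_nonneg: "norm z \<le> 1 \<Longrightarrow> poisson z w \<ge> 0"
  by (simp add: poisson_def power_le_one)

text \<open>On the unit circle \<open>cnj w\<close> is the inverse of \<open>w\<close>, so
  \<open>(norm (w - z))^2 * w\<close> factors. The result is the Cauchy kernel
  \<open>1 / (w - z)\<close> times a factor holomorphic on the closed disc, times the
  \<open>w\<close> that belongs to \<open>dw = i w dt\<close>.\<close>

lemma poisson_eq:
  fixes z w :: complex
  assumes "norm w = 1" "norm z < 1"
  shows "complex_of_real (poisson z w) = (1 - (norm z)\<^sup>2) * w / ((w - z) * (1 - cnj z * w))"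
proof -
  have w: "w * cnj w = 1" using assms(1) by (simp add: complex_norm_square[symmetric])
  have "complex_of_real ((norm (w - z))\<^sup>2) * w = (w - z) * (cnj w * w - cnj z * w)"
    by (subst complex_norm_square) (simp add: algebra_simps)
  also have "\<dots> = (w - z) * (1 - cnj z * w)" using w by (simp add: mult.commute)
  finally have *: "complex_of_real ((norm (w - z))\<^sup>2) * w = (w - z) * (1 - cnj z * w)" .
  have "w \<noteq> 0" "w \<noteq> z" using assms by auto
  then show ?thesis
    unfolding poisson_def *[symmetric] by simp
qed

text \<open>On the circle \<open>1 - cnj z * w\<close> equals \<open>w * cnj (w - z)\<close> and so
  has the modulus of \<open>w - z\<close>. The kernel thus becomes the boundary value of the real
  part of a holomorphic function, to which a second Poisson kernel can be applied.\<close>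

lemma poisson_eq_Re:
  fixes z w :: complex
  assumes "norm w = 1" "norm z < 1"
  shows "poisson z w = Re ((1 + cnj z * w) / (1 - cnj z * w))"
proof -
  have w: "w * cnj w = 1" using assms(1) by (simp add: complex_norm_square[symmetric])
  let ?a = "cnj z * w"
  have "(norm (1 - ?a))\<^sup>2 = (norm (w - z))\<^sup>2"
  proof -
    have "1 - ?a = w * cnj (w - z)" using w by (simp add: algebra_simps)
    then show ?thesis using assms by (simp only: norm_mult complex_mod_cnj mult_1)
  qed
  moreover have "Re ((1 + ?a) / (1 - ?a)) = (1 - (norm ?a)\<^sup>2) / (norm (1 - ?a))\<^sup>2"
    unfolding complex_div_cnj[of "1 + ?a"] cmod_power2 Re_divide_of_real
    by (simp add: Re_divide cmod_power2 algebra_simps power2_eq_square flip: of_real_power)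
  moreover have "norm ?a = norm z" using assms by (simp add: norm_mult)
  ultimately show ?thesis by (simp add: poisson_def)
qed

lemma disc_denominator_nonzero:
  fixes z w :: complex
  assumes "norm z < 1" "norm w \<le> 1"
  shows "1 - cnj z * w \<noteq> 0"
proof
  assume "1 - cnj z * w = 0"
  then have "norm (cnj z * w) = 1" by (metis eq_iff_diff_eq_0 norm_one)
  moreover have "norm (cnj z * w) \<le> norm z * 1"
    using assms mult_left_mono[of "norm w" 1 "norm z"] by (simp add: norm_mult)
  ultimately show False using assms by simp
qed

text \<open>Cauchy's formula is applied to \<open>g\<close>, which is \<open>F\<close> times
  \<open>(1 - |z|^2) / (1 - cnj z * u)\<close>. This factor is holomorphic on the closed disc and
  equals \<open>1\<close> at \<open>u = z\<close>; by \<open>poisson_eq\<close> it turns the Cauchy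
  integrand into the Poisson integrand.\<close>

lemma poisson_holomorphic:
  fixes z :: complex and F :: "complex \<Rightarrow> complex"
  assumes F: "F holomorphic_on cball 0 1" and z: "norm z < 1"
  shows "((\<lambda>t. poisson z (cis t) * F (cis t)) has_integral 2 * pi * F z) {0..2*pi}"
proof -
  define g where "g u = F u * (1 - (norm z)\<^sup>2) / (1 - cnj z * u)" for u
  have nz: "1 - cnj z * u \<noteq> 0" if "u \<in> cball 0 1" for u
    using disc_denominator_nonzero[OF z, of u] that by simp
  have "g holomorphic_on cball 0 1"
    unfolding g_def by (intro holomorphic_intros F nz)
  then have "((\<lambda>u. g u / (u - z)) has_contour_integral 2 * of_real pi * \<i> * g z) (circlepath 0 1)"
    using z by (intro Cauchy_integral_circlepath_simple) auto
  then have "((\<lambda>t. g (cis t) / (cis t - z) * \<i> * cis t) has_integral 2 * of_real pi * \<i> * g z) {0..2*pi}"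
    by (simp add: circlepath_def has_contour_integral_part_circlepath_iff)
  then have "((\<lambda>t. - \<i> * (g (cis t) / (cis t - z) * \<i> * cis t)) has_integral
      - \<i> * (2 * of_real pi * \<i> * g z)) {0..2*pi}"
    by (rule has_integral_mult_right)
  moreover have "- \<i> * (g (cis t) / (cis t - z) * \<i> * cis t) = poisson z (cis t) * F (cis t)" for t
    using z by (simp add: poisson_eq g_def mult_ac)
  moreover have "g z = F z"
  proof -
    have "cnj z * z = complex_of_real ((norm z)\<^sup>2)" by (metis complex_norm_square mult.commute)
    then have "1 - (norm z)\<^sup>2 = 1 - cnj z * z" by simp
    then show ?thesis using nz[of z] z unfolding g_def by (metis (no_types) less_imp_le mem_cball_0 nonzero_mult_div_cancel_right)
  qed
  ultimately show ?thesis by (simp add: mult_ac)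
qed

text \<open>The kernel is real, so the formula for \<open>H\<close> can be conjugated and added to
  the one for \<open>G\<close>.\<close>

lemma poisson_harmonic:
  fixes z :: complex and F :: "complex \<Rightarrow> complex"
  assumes G: "G holomorphic_on cball 0 1" and H: "H holomorphic_on cball 0 1" and z: "norm z < 1"
    and F: "\<And>w. norm w \<le> 1 \<Longrightarrow> F w = G w + cnj (H w)"
  shows "((\<lambda>t. poisson z (cis t) * F (cis t)) has_integral 2 * pi * F z) {0..2*pi}"
proof -
  have "((\<lambda>t. poisson z (cis t) * G (cis t) + cnj (poisson z (cis t) * H (cis t)))
      has_integral (2 * pi * G z + cnj (2 * pi * H z))) {0..2*pi}"
    by (intro has_integral_add poisson_holomorphic assms has_integral_cnj[THEN iffD2, unfolded o_def])
  then show ?thesis using z by (simp add: F distrib_left)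
qed

lemma poisson_integral_1:
  fixes z :: complex
  assumes "norm z < 1"
  shows "((\<lambda>t. poisson z (cis t)) has_integral 2 * pi) {0..2*pi}"
  using has_integral_Re[OF poisson_holomorphic[OF holomorphic_on_const assms, of 1]] by simp

text \<open>By \<open>poisson_eq_Re\<close> one kernel is the boundary value of the real part of a
  holomorphic function, and the other reproduces that function at \<open>z\<close>. Up to
  normalization this is the kernel of the Poisson operator composed with its adjoint.\<close>

lemma poisson_kernel_product:
  fixes z \<zeta> :: complex
  assumes z: "norm z < 1" and \<zeta>: "norm \<zeta> < 1"
  shows "((\<lambda>t. poisson z (cis t) * poisson \<zeta> (cis t)) has_integral
           2 * pi * Re ((1 + cnj \<zeta> * z) / (1 - cnj \<zeta> * z))) {0..2*pi}"
proof -
  let ?F = "\<lambda>w. (1 + cnj \<zeta> * w) / (1 - cnj \<zeta> * w)"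
  have "?F holomorphic_on cball 0 1"
    using disc_denominator_nonzero[OF \<zeta>] by (intro holomorphic_intros) auto
  from has_integral_Re[OF poisson_holomorphic[OF this z]]
  show ?thesis using \<zeta> by (simp add: poisson_eq_Re del: times_divide_eq_right)
qed

lemma Re_cayley_le:
  fixes z \<zeta> :: complex
  assumes "norm z < 1" "norm \<zeta> < 1"
  shows "Re ((1 + cnj \<zeta> * z) / (1 - cnj \<zeta> * z)) \<le> 2 / norm (1 - cnj \<zeta> * z)"
proof -
  have "norm (cnj \<zeta> * z) \<le> 1" using assms by (auto simp: norm_mult intro!: mult_le_one)
  then have "norm (1 + cnj \<zeta> * z) \<le> 2" using norm_triangle_ineq[of 1 "cnj \<zeta> * z"] by simp
  then have "norm ((1 + cnj \<zeta> * z) / (1 - cnj \<zeta> * z)) \<le> 2 / norm (1 - cnj \<zeta> * z)"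
    by (simp add: norm_divide divide_right_mono)
  then show ?thesis using complex_Re_le_cmod order_trans by blast
qed

section \<open>Weighted integrals over the disc\<close>

lemma cis_measurable [measurable]: "cis \<in> borel_measurable borel"
  by (intro borel_measurable_continuous_onI continuous_intros)

lemma indicator_disc_measurable [measurable]:
  "(indicator (ball 0 1) :: complex \<Rightarrow> ennreal) \<in> borel_measurable borel"
  by (intro borel_measurable_indicator) simp

lemma emeasure_complex_ball: "r \<ge> 0 \<Longrightarrow> emeasure lborel (ball (c::complex) r) = ennreal (pi * r\<^sup>2)"
  by (simp add: emeasure_ball unit_ball_vol_2)

lemma emeasure_complex_cball: "r \<ge> 0 \<Longrightarrow> emeasure lborel (cball (c::complex) r) = ennreal (pi * r\<^sup>2)"
  by (simp add: emeasure_cball unit_ball_vol_2)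

text \<open>The squared modulus carries area on the disc to \<open>pi\<close> times Lebesgue measure
  on the unit interval, since the ring \<open>x < |z|^2 < 1\<close> has area
  \<open>pi * (1 - x)\<close>. Squaring the radius makes the Jacobian constant.\<close>

lemma nn_integral_disc_radial:
  fixes g :: "real \<Rightarrow> ennreal"
  assumes [measurable]: "g \<in> borel_measurable borel"
  shows "(\<integral>\<^sup>+z. indicator (ball 0 1) z * g ((norm z)\<^sup>2) \<partial>(lborel :: complex measure)) =
    ennreal pi * (\<integral>\<^sup>+t. indicator {0..1} t * g t \<partial>lborel)"
proof -
  let ?N = "density (lborel :: complex measure) (indicator (ball 0 1))"
  let ?M = "distr ?N borel (\<lambda>z. (norm z)\<^sup>2)"
  let ?M' = "density lborel (\<lambda>t. ennreal pi * indicator {0..1::real} t)"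
  have "?M = ?M'"
  \<comment> \<open>Half-lines of finite measure determine both measures, so only areas of rings and
    discs have to be compared.\<close>
  proof (rule measure_eqI_lessThan)
    fix x :: real
    have eq: "emeasure ?M {x<..} = emeasure lborel (ball 0 1 \<inter> {z::complex. (norm z)\<^sup>2 > x})"
    proof -
      have "emeasure ?M {x<..} = emeasure ?N ((\<lambda>z. (norm z)\<^sup>2) -` {x<..} \<inter> space ?N)"
        by (rule emeasure_distr) auto
      also have "(\<lambda>z. (norm z)\<^sup>2) -` {x<..} \<inter> space ?N = {z::complex. (norm z)\<^sup>2 > x}" by auto
      also have "emeasure ?N \<dots> = emeasure lborel (ball 0 1 \<inter> {z::complex. (norm z)\<^sup>2 > x})"
        by (subst emeasure_density)
          (simp_all only: indicator_inter_arith[symmetric] nn_integral_indicator, simp_all)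
      finally show ?thesis .
    qed
    have eq': "emeasure ?M' {x<..} = ennreal pi * emeasure lborel ({0..1} \<inter> {x<..})"
      by (subst emeasure_density)
        (auto simp: mult.assoc nn_integral_cmult simp flip: indicator_inter_arith)
    consider "x < 0" | "0 \<le> x" "x < 1" | "x \<ge> 1" by linarith
    then have "emeasure lborel (ball 0 1 \<inter> {z::complex. (norm z)\<^sup>2 > x})
        = ennreal pi * emeasure lborel ({0..1} \<inter> {x<..})"
    proof cases
      case 1
      then have "x < (norm z)\<^sup>2" for z :: complex
        by (rule less_le_trans) simp
      then have "ball 0 1 \<inter> {z::complex. (norm z)\<^sup>2 > x} = ball 0 1" by auto
      moreover from 1 have "{0..1} \<inter> {x<..} = {0..1}" by auto
      ultimately show ?thesis by (simp add: emeasure_complex_ball)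
    next
      case 2
      have "x < (norm z)\<^sup>2 \<longleftrightarrow> \<not> norm z \<le> sqrt x" for z :: complex
        using real_sqrt_less_iff[of x "(norm z)\<^sup>2"] by (simp add: not_le)
      then have "ball 0 1 \<inter> {z::complex. (norm z)\<^sup>2 > x} = ball 0 1 - cball 0 (sqrt x)"
        unfolding set_eq_iff Int_iff Diff_iff mem_Collect_eq mem_cball_0 by blast
      moreover have "cball 0 (sqrt x) \<subseteq> ball (0::complex) 1"
      proof -
        have "sqrt x < 1" using 2 by simp
        then show ?thesis by (auto simp: subset_eq simp del: real_sqrt_lt_1_iff)
      qed
      moreover from 2 have "{0..1} \<inter> {x<..} = {x<..1}" by auto
      moreover have "ennreal pi * ennreal (1 - x) = ennreal (pi - pi * x)"
        using 2 by (simp add: right_diff_distrib flip: ennreal_mult')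
      ultimately show ?thesis using 2
        by (simp add: emeasure_Diff emeasure_complex_ball emeasure_complex_cball ennreal_minus)
    next
      case 3
      have "(norm z)\<^sup>2 \<le> x" if "norm z < 1" for z :: complex
        using power_le_one[of "norm z" 2] that 3 by (meson less_imp_le norm_ge_zero order_trans)
      then have "ball 0 1 \<inter> {z::complex. (norm z)\<^sup>2 > x} = {}"
        by (force dest: leD)
      moreover from 3 have "{0..1} \<inter> {x<..} = {}" by auto
      ultimately show ?thesis by simp
    qed
    with eq eq' show "emeasure ?M {x<..} = emeasure ?M' {x<..}" by simp
    have "emeasure lborel (ball 0 1 \<inter> {z::complex. (norm z)\<^sup>2 > x}) \<le> emeasure lborel (ball (0::complex) 1)"
      by (rule emeasure_mono) auto
    then show "emeasure ?M {x<..} < \<infinity>"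
      by (metis eq emeasure_lborel_ball_finite order_le_less_trans)
  qed auto
  then have "(\<integral>\<^sup>+t. g t \<partial>?M) = (\<integral>\<^sup>+t. g t \<partial>?M')" by simp
  moreover have "(\<integral>\<^sup>+t. g t \<partial>?M) = (\<integral>\<^sup>+z. indicator (ball 0 1) z * g ((norm z)\<^sup>2) \<partial>(lborel :: complex measure))"
    by (simp add: nn_integral_distr nn_integral_density)
  moreover have "(\<integral>\<^sup>+t. g t \<partial>?M') = ennreal pi * (\<integral>\<^sup>+t. indicator {0..1} t * g t \<partial>lborel)"
    by (simp add: nn_integral_density mult.assoc nn_integral_cmult)
  ultimately show ?thesis by simp
qed

text \<open>One factor of the density of the Bergman measure. The indicator lets integrals run over
  the whole plane, so that Fubini for \<open>lborel\<close> applies directly.\<close>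

definition disc_weight :: "nat \<Rightarrow> complex \<Rightarrow> real" where
  "disc_weight m z = indicator (ball 0 1) z * ((real m - 1) / pi * (1 - (norm z)\<^sup>2) ^ (m - 2))"

lemma disc_weight_measurable [measurable]: "disc_weight m \<in> borel_measurable borel"
  unfolding disc_weight_def[abs_def]
  by (intro borel_measurable_times borel_measurable_indicator borel_measurable_continuous_onI
        continuous_intros) simp

lemma disc_weight_nonneg: "m \<ge> 1 \<Longrightarrow> disc_weight m z \<ge> 0"
  by (auto simp: disc_weight_def indicator_def power_le_one)

lemma nn_integral_disc_weight:
  assumes m: "m \<ge> 2"
  shows "(\<integral>\<^sup>+z. ennreal (disc_weight m z) \<partial>lborel) = 1"
proof -
  let ?g = "\<lambda>t. ennreal ((real m - 1) / pi * (1 - t) ^ (m - 2))"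
  have "(\<integral>\<^sup>+z. ennreal (disc_weight m z) \<partial>lborel) =
      (\<integral>\<^sup>+z. indicator (ball 0 1) z * ?g ((norm z)\<^sup>2) \<partial>(lborel :: complex measure))"
    by (intro nn_integral_cong) (auto simp: disc_weight_def indicator_def)
  also have "\<dots> = ennreal pi * (\<integral>\<^sup>+t. indicator {0..1} t * ?g t \<partial>lborel)"
    by (rule nn_integral_disc_radial) simp
  also have "(\<integral>\<^sup>+t. indicator {0..1} t * ?g t \<partial>lborel) = (\<integral>\<^sup>+t. ?g t * indicator {0..1} t \<partial>lborel)"
    by (simp add: mult.commute)
  also have "\<dots> = ennreal (0 - (- (1 / pi)))"
  proof (rule nn_integral_has_integral_lebesgue')
    let ?G = "\<lambda>t. - ((1 - t) ^ (m - 1) / pi) :: real"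
    have "((\<lambda>t. (real m - 1) / pi * (1 - t) ^ (m - 2)) has_integral ?G 1 - ?G 0) {0..1}"
    proof (rule fundamental_theorem_of_calculus)
      fix t :: real
      have "m - 1 - Suc 0 = m - 2" "real (m - 1) = real m - 1" using m by auto
      then show "(?G has_vector_derivative (real m - 1) / pi * (1 - t) ^ (m - 2)) (at t within {0..1})"
        unfolding has_real_derivative_iff_has_vector_derivative[symmetric]
        by (auto intro!: derivative_eq_intros simp: field_simps)
    qed simp
    then show "((\<lambda>t. (real m - 1) / pi * (1 - t) ^ (m - 2)) has_integral 0 - (- (1 / pi))) {0..1}"
      using m by (simp add: zero_power)
  qed (use m in auto)
  finally show ?thesis by (simp flip: ennreal_mult')
qed

text \<open>With \<open>s = sqrt ((1 - t) / e)\<close> the integrand becomes a multiple of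
  \<open>1 / (1 + s^2)\<close>. Because of the singularity at \<open>t = 1\<close> the primitive is
  differentiated in the open interval only and is continuous on the closed one.\<close>

lemma has_integral_inverse_sqrt_Cauchy:
  fixes e :: real
  assumes "e > 0"
  shows "((\<lambda>t. 1 / (sqrt (1 - t) * (e + (1 - t)))) has_integral
           2 * arctan (sqrt (1 / e)) / sqrt e) {0..1}"
proof -
  let ?G = "\<lambda>t. - 2 / sqrt e * arctan (sqrt ((1 - t) / e))"
  have "((\<lambda>t. 1 / (sqrt (1 - t) * (e + (1 - t)))) has_integral ?G 1 - ?G 0) {0..1}"
  proof (rule fundamental_theorem_of_calculus_interior)
    show "continuous_on {0..1} ?G" using assms by (intro continuous_intros) auto
    fix t :: real assume t: "t \<in> {0<..<1}"
    define r where "r = sqrt ((1 - t) / e)"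
    have r: "r > 0" "r\<^sup>2 = (1 - t) / e" "sqrt (1 - t) = sqrt e * r"
      using t assms by (auto simp: r_def) (simp add: real_sqrt_divide)
    have "((\<lambda>t. arctan (sqrt ((1 - t) / e))) has_real_derivative
        inverse (1 + r\<^sup>2) * (inverse r / 2 * (- 1 / e))) (at t)"
      unfolding r_def using t assms by (auto intro!: derivative_eq_intros simp: divide_less_0_iff)
    from DERIV_cmult[OF this, of "- 2 / sqrt e"]
    have "(?G has_real_derivative - 2 / sqrt e * (inverse (1 + r\<^sup>2) * (inverse r / 2 * (- 1 / e)))) (at t)" .
    also have "- 2 / sqrt e * (inverse (1 + r\<^sup>2) * (inverse r / 2 * (- 1 / e)))
        = 1 / (sqrt e * r * (e * (1 + r\<^sup>2)))"
      by (simp add: divide_simps)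
    also have "e * (1 + r\<^sup>2) = e + (1 - t)" using assms by (simp add: r(2) field_simps)
    finally have "(?G has_real_derivative 1 / (sqrt (1 - t) * (e + (1 - t)))) (at t)"
      by (simp only: r(3))
    then show "(?G has_vector_derivative 1 / (sqrt (1 - t) * (e + (1 - t)))) (at t)"
      by (simp add: has_real_derivative_iff_has_vector_derivative)
  qed simp
  then show ?thesis by simp
qed

section \<open>Normalized averages over the circle\<close>

definition circle_weight :: "real \<Rightarrow> real" where
  "circle_weight t = indicator {0..2*pi} t / (2 * pi)"

lemma circle_weight_measurable [measurable]: "circle_weight \<in> borel_measurable borel"
  unfolding circle_weight_def[abs_def] by measurable

text \<open>Bridge from gauge integrals, in which the Poisson formulas are stated, to the
  nonnegative Lebesgue integrals of the Fubini arguments.\<close>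

lemma nn_integral_circle_weight:
  assumes "\<And>t. t \<in> {0..2*pi} \<Longrightarrow> f t \<ge> 0" and "(f has_integral 2 * pi * I) {0..2*pi}"
  shows "(\<integral>\<^sup>+t. ennreal (circle_weight t) * ennreal (f t) \<partial>lborel) = ennreal I"
proof -
  have "((\<lambda>t. f t * (1 / (2 * pi))) has_integral 2 * pi * I * (1 / (2 * pi))) {0..2*pi}"
    by (rule has_integral_mult_left) (rule assms)
  then have "((\<lambda>t. f t * (1 / (2 * pi))) has_integral I) {0..2*pi}" by simp
  then have "(\<integral>\<^sup>+t. ennreal (f t * (1 / (2 * pi))) * indicator {0..2*pi} t \<partial>lborel) = ennreal I"
    by (rule nn_integral_has_integral_lebesgue'[rotated]) (use assms(1) in auto)
  moreover have "ennreal (f t * (1 / (2 * pi))) * indicator {0..2*pi} t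
      = ennreal (circle_weight t) * ennreal (f t)" for t
    using assms(1)[of t] by (auto simp: circle_weight_def indicator_def field_simps simp flip: ennreal_mult')
  ultimately show ?thesis by simp
qed

lemma nn_integral_circle_weight_1: "(\<integral>\<^sup>+t. ennreal (circle_weight t) \<partial>lborel) = 1"
proof -
  have "((\<lambda>_. 1 :: real) has_integral 2 * pi * 1) {0..2*pi}"
    using has_integral_const_real[of "1::real" 0 "2*pi"] by simp
  from nn_integral_circle_weight[OF _ this] show ?thesis by simp
qed

section \<open>Rotation averages and the Schur estimate in the disc\<close>

lemma nn_integral_complex_rotation:
  assumes [measurable]: "f \<in> borel_measurable borel"
  shows "(\<integral>\<^sup>+z. f (cis t * z) \<partial>lborel) = (\<integral>\<^sup>+z. f z \<partial>lborel)"
proof -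
  have "orthogonal_transformation (\<lambda>z. cis t * z)"
    by (auto simp: orthogonal_transformation norm_mult bounded_linear.linear[OF bounded_linear_mult_right])
  then have *: "distr lborel borel (\<lambda>z. cis t * z) = (lborel :: complex measure)"
    by (rule lborel_distr_orthogonal)
  show ?thesis by (subst (2) *[symmetric], subst nn_integral_distr) auto
qed

text \<open>A constant multiple of the modulus of the Szego kernel of the disc.\<close>

definition disc_kernel :: "complex \<Rightarrow> complex \<Rightarrow> real" where
  "disc_kernel z \<zeta> = 2 / norm (1 - cnj \<zeta> * z)"

lemma disc_kernel_nonneg: "disc_kernel z \<zeta> \<ge> 0"
  by (simp add: disc_kernel_def)

lemma disc_kernel_commute: "disc_kernel z \<zeta> = disc_kernel \<zeta> z"
proof -
  have "1 - cnj \<zeta> * z = cnj (1 - cnj z * \<zeta>)" by simp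
  then show ?thesis unfolding disc_kernel_def by (metis complex_mod_cnj)
qed

lemma disc_kernel_measurable [measurable]:
  "(\<lambda>(z, \<zeta>). disc_kernel z \<zeta>) \<in> borel_measurable (borel \<Otimes>\<^sub>M borel)"
proof -
  have "(\<lambda>x::complex \<times> complex. norm (1 - cnj (snd x) * fst x)) \<in> borel_measurable borel"
    by (intro borel_measurable_continuous_onI continuous_intros)
  then show ?thesis unfolding disc_kernel_def case_prod_unfold borel_prod by simp
qed

text \<open>As \<open>norm (1 - cnj (cis t) * a)\<close> equals \<open>norm (cis t - a)\<close>, the
  integrand is the Poisson kernel at \<open>a\<close> divided by \<open>1 - |a|^2\<close>, and the
  Poisson kernel has mean \<open>1\<close>.\<close>

lemma circle_average_inverse_square:
  assumes "norm a < 1"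
  shows "(\<integral>\<^sup>+t. ennreal (circle_weight t) * ennreal (1 / (norm (1 - cnj (cis t) * a))\<^sup>2) \<partial>lborel)
    = ennreal (1 / (1 - (norm a)\<^sup>2))"
proof (rule nn_integral_circle_weight)
  have pos: "1 - (norm a)\<^sup>2 > 0" using assms by (simp add: power_less_one_iff)
  have "norm (1 - cnj (cis t) * a) = norm (cis t - a)" for t
  proof -
    have "cis t - a = cis t * (1 - cnj (cis t) * a)" by (simp add: algebra_simps cis_cnj cis_mult)
    then show ?thesis by (simp only: norm_mult norm_cis mult_1)
  qed
  then have eq: "1 / (norm (1 - cnj (cis t) * a))\<^sup>2 = poisson a (cis t) * (1 / (1 - (norm a)\<^sup>2))" for t
    using pos by (simp add: poisson_def)
  show "((\<lambda>t. 1 / (norm (1 - cnj (cis t) * a))\<^sup>2) has_integral 2 * pi * (1 / (1 - (norm a)\<^sup>2))) {0..2*pi}"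
    unfolding eq by (intro has_integral_mult_left poisson_integral_1 assms)
qed simp

(* Averaging over rotations of the variable turns the first factor into a Poisson integral. *)
lemma disc_schur_2:
  assumes z: "norm z < 1"
  shows "(\<integral>\<^sup>+\<zeta>. indicator (ball 0 1) \<zeta> * ennreal (1 / ((norm (1 - cnj \<zeta> * z))\<^sup>2 * sqrt (1 - (norm \<zeta>)\<^sup>2))) \<partial>lborel)
    \<le> ennreal (2 * pi\<^sup>2 / sqrt (1 - (norm z)\<^sup>2))" (is "(\<integral>\<^sup>+\<zeta>. ?F \<zeta> \<partial>lborel) \<le> _")
proof -
  define e where "e = 1 - (norm z)\<^sup>2"
  have e: "e > 0" "e \<le> 1" using z by (auto simp: e_def power_less_one_iff)
  have [measurable]: "(\<lambda>\<zeta>. norm (1 - cnj \<zeta> * z)) \<in> borel_measurable borel"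
    by (intro borel_measurable_continuous_onI continuous_intros)
  have F[measurable]: "?F \<in> borel_measurable borel" by measurable
  \<comment> \<open>What remains of the integrand after the angle has been averaged out, as a
    function of \<open>u = |\<zeta>|^2\<close>.\<close>
  let ?g = "\<lambda>u. ennreal (1 / ((1 - u * (norm z)\<^sup>2) * sqrt (1 - u)))"
  \<comment> \<open>The integral over the rotated variable does not depend on \<open>t\<close>, so
    averaging it over the circle changes nothing. Exchanging the integrals then puts the average
    inside.\<close>
  have "(\<integral>\<^sup>+\<zeta>. ?F \<zeta> \<partial>lborel) = (\<integral>\<^sup>+t. ennreal (circle_weight t) * (\<integral>\<^sup>+\<zeta>. ?F (cis t * \<zeta>) \<partial>lborel) \<partial>lborel)"
    by (simp only: nn_integral_complex_rotation[OF F])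
      (subst nn_integral_multc, simp_all add: nn_integral_circle_weight_1)
  also have "\<dots> = (\<integral>\<^sup>+t. (\<integral>\<^sup>+\<zeta>. ennreal (circle_weight t) * ?F (cis t * \<zeta>) \<partial>lborel) \<partial>lborel)"
    by (intro nn_integral_cong nn_integral_cmult[symmetric]) measurable
  also have "\<dots> = (\<integral>\<^sup>+\<zeta>. (\<integral>\<^sup>+t. ennreal (circle_weight t) * ?F (cis t * \<zeta>) \<partial>lborel) \<partial>lborel)"
    by (rule lborel_pair.Fubini') measurable
  also have "\<dots> = (\<integral>\<^sup>+\<zeta>. indicator (ball 0 1) \<zeta> * ?g ((norm \<zeta>)\<^sup>2) \<partial>(lborel :: complex measure))"
  proof (rule nn_integral_cong)
    fix \<zeta> :: complex
    show "(\<integral>\<^sup>+t. ennreal (circle_weight t) * ?F (cis t * \<zeta>) \<partial>lborel) = indicator (ball 0 1) \<zeta> * ?g ((norm \<zeta>)\<^sup>2)"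
    proof (cases "norm \<zeta> < 1")
      case True
      \<comment> \<open>Then \<open>cnj (cis t * \<zeta>) * z\<close> is
        \<open>cnj (cis t) * a\<close>, the form in which
        \<open>circle_average_inverse_square\<close> applies.\<close>
      define a where "a = cnj \<zeta> * z"
      have "norm a \<le> norm z" using True by (simp add: a_def norm_mult mult_left_le_one_le)
      then have a: "norm a < 1" using z by simp
      have [measurable]: "(\<lambda>t. norm (1 - cnj (cis t) * a)) \<in> borel_measurable borel"
        by (intro borel_measurable_continuous_onI continuous_intros)
      have "?F (cis t * \<zeta>) = ennreal (1 / (norm (1 - cnj (cis t) * a))\<^sup>2) * ennreal (1 / sqrt (1 - (norm \<zeta>)\<^sup>2))" for t
        using True by (simp add: a_def norm_mult mult.assoc flip: ennreal_mult')
      then have "(\<integral>\<^sup>+t. ennreal (circle_weight t) * ?F (cis t * \<zeta>) \<partial>lborel)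
        = (\<integral>\<^sup>+t. ennreal (circle_weight t) * ennreal (1 / (norm (1 - cnj (cis t) * a))\<^sup>2) \<partial>lborel)
            * ennreal (1 / sqrt (1 - (norm \<zeta>)\<^sup>2))"
        by (simp only: mult.assoc[symmetric]) (rule nn_integral_multc, simp)
      also have "\<dots> = ?g ((norm \<zeta>)\<^sup>2)"
        unfolding circle_average_inverse_square[OF a]
        using True power_le_one[of "norm a" 2] a
        by (simp add: a_def norm_mult power_mult_distrib flip: ennreal_mult')
      finally show ?thesis using True by simp
    qed (simp add: norm_mult)
  qed
  also have "\<dots> = ennreal pi * (\<integral>\<^sup>+u. indicator {0..1} u * ?g u \<partial>lborel)"
    by (rule nn_integral_disc_radial) measurable
  finally have eq: "(\<integral>\<^sup>+\<zeta>. ?F \<zeta> \<partial>lborel) = ennreal pi * (\<integral>\<^sup>+u. indicator {0..1} u * ?g u \<partial>lborel)" .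
  have "(\<integral>\<^sup>+u. indicator {0..1} u * ?g u \<partial>lborel)
      \<le> (\<integral>\<^sup>+u. ennreal (1 / (sqrt (1 - u) * (e + (1 - u))) * 2) * indicator {0..1} u \<partial>lborel)"
  proof (rule nn_integral_mono)
    fix u :: real
    \<comment> \<open>As \<open>(norm z)^2 = 1 - e\<close>, the factor
      \<open>1 - u * (norm z)^2\<close> is at least half of \<open>e + (1 - u)\<close>: twice the
      former minus the latter is \<open>(1 - e) * (1 - u) + u * e\<close>. At \<open>u = 1\<close>
      both sides are \<open>0\<close> by division by zero.\<close>
    have *: "1 / ((1 - u * (norm z)\<^sup>2) * sqrt (1 - u)) \<le> 1 / (sqrt (1 - u) * (e + (1 - u))) * 2" if u: "u \<in> {0..1}"
    proof (cases "u = 1")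
      case False
      then have s: "sqrt (1 - u) > 0" and p: "e + (1 - u) > 0" using u e by auto
      have "2 * (1 - u * (norm z)\<^sup>2) - (e + (1 - u)) = (1 - e) * (1 - u) + u * e"
        by (simp add: e_def algebra_simps)
      moreover have "\<dots> \<ge> 0" using u e by simp
      ultimately have "(e + (1 - u)) / 2 \<le> 1 - u * (norm z)\<^sup>2" by simp
      then have "1 / ((1 - u * (norm z)\<^sup>2) * sqrt (1 - u)) \<le> 1 / (((e + (1 - u)) / 2) * sqrt (1 - u))"
        using s p by (intro divide_left_mono mult_right_mono mult_pos_pos) auto
      then show ?thesis by (simp add: mult.commute)
    qed simp
    show "indicator {0..1} u * ?g u \<le> ennreal (1 / (sqrt (1 - u) * (e + (1 - u))) * 2) * indicator {0..1} u"
    proof (cases "u \<in> {0..1}")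
      case True
      from ennreal_leI[OF *[OF this]] True show ?thesis by (simp only: indicator_simps mult_1 mult_1_right)
    qed (simp only: indicator_simps mult_zero_left mult_zero_right order_refl not_False_eq_True)
  qed
  also have "\<dots> = ennreal (2 * arctan (sqrt (1 / e)) / sqrt e * 2)"
  proof (rule nn_integral_has_integral_lebesgue')
    show "((\<lambda>u. 1 / (sqrt (1 - u) * (e + (1 - u))) * 2) has_integral 2 * arctan (sqrt (1 / e)) / sqrt e * 2) {0..1}"
      by (rule has_integral_mult_left) (rule has_integral_inverse_sqrt_Cauchy[OF e(1)])
  qed (use e in simp)
  also have "\<dots> \<le> ennreal (2 * pi / sqrt e)"
    using e arctan_ubound[of "sqrt (1 / e)"]
    by (intro ennreal_leI) (simp add: field_simps)
  finally have "(\<integral>\<^sup>+\<zeta>. ?F \<zeta> \<partial>lborel) \<le> ennreal pi * ennreal (2 * pi / sqrt e)"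
    unfolding eq by (rule mult_left_mono) simp
  also have "ennreal pi * ennreal (2 * pi / sqrt e) = ennreal (2 * pi\<^sup>2 / sqrt e)"
    by (simp add: power2_eq_square mult.left_commute flip: ennreal_mult')
  finally show ?thesis by (simp add: e_def)
qed

text \<open>The factors are the constant of the density, \<open>2 ^ m\<close> from the numerators of
  the kernel, \<open>2 ^ (m - 2)\<close> from bounding \<open>1 - |\<zeta>|^2\<close> by
  \<open>2 |1 - cnj \<zeta> * z|\<close>, and the constant of \<open>disc_schur_2\<close>.\<close>

definition disc_schur_const :: "nat \<Rightarrow> real" where
  "disc_schur_const m = (real m - 1) / pi * (2 ^ m * 2 ^ (m - 2)) * (2 * pi\<^sup>2)"

(* Since 1 - |zeta|^2 <= 2 |1 - cnj zeta * z|, the case m = 2 implies the general one. *)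
lemma disc_schur:
  assumes z: "norm z < 1" and m: "m \<ge> 2"
  shows "(\<integral>\<^sup>+\<zeta>. ennreal (disc_weight m \<zeta> * (disc_kernel z \<zeta> ^ m / sqrt (1 - (norm \<zeta>)\<^sup>2))) \<partial>lborel)
    \<le> ennreal (disc_schur_const m / sqrt (1 - (norm z)\<^sup>2))"
proof -
  let ?c = "(real m - 1) / pi * (2 ^ m * 2 ^ (m - 2))"
  let ?F = "\<lambda>\<zeta>. indicator (ball 0 1) \<zeta> * ennreal (1 / ((norm (1 - cnj \<zeta> * z))\<^sup>2 * sqrt (1 - (norm \<zeta>)\<^sup>2)))"
  have c: "?c \<ge> 0" using m by simp
  have "ennreal (disc_weight m \<zeta> * (disc_kernel z \<zeta> ^ m / sqrt (1 - (norm \<zeta>)\<^sup>2))) \<le> ennreal ?c * ?F \<zeta>" for \<zeta>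
  proof (cases "norm \<zeta> < 1")
    case True
    define d where "d = norm (1 - cnj \<zeta> * z)"
    have d: "d > 0" using disc_denominator_nonzero[OF True, of z] z by (simp add: d_def)
    define s where "s = sqrt (1 - (norm \<zeta>)\<^sup>2)"
    have s: "s \<ge> 0" using True by (simp add: s_def power_le_one)
    have "norm (cnj \<zeta> * z) \<le> norm \<zeta>" using z by (simp add: norm_mult mult_left_le)
    then have "1 - norm \<zeta> \<le> d" using norm_triangle_ineq2[of 1 "cnj \<zeta> * z"] by (simp add: d_def)
    moreover have "1 - (norm \<zeta>)\<^sup>2 \<le> 2 * (1 - norm \<zeta>)"
      using zero_le_power2[of "1 - norm \<zeta>"] by (simp add: power2_diff)
    ultimately have "1 - (norm \<zeta>)\<^sup>2 \<le> 2 * d" by simp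
    then have "(1 - (norm \<zeta>)\<^sup>2) ^ (m - 2) \<le> (2 * d) ^ (m - 2)"
      using True by (intro power_mono) (simp_all add: power_le_one)
    then have "(real m - 1) / pi * (1 - (norm \<zeta>)\<^sup>2) ^ (m - 2) * ((2 / d) ^ m / s)
        \<le> (real m - 1) / pi * (2 * d) ^ (m - 2) * ((2 / d) ^ m / s)"
      using m d s by (intro mult_right_mono mult_left_mono) auto
    \<comment> \<open>The exponent splits as \<open>m = 2 + (m - 2)\<close>: the powers
      \<open>d ^ (m - 2)\<close> cancel and the kernel of the case \<open>m = 2\<close>
      remains.\<close>
    also have "\<dots> = ?c * (1 / (d\<^sup>2 * s))"
    proof -
      have "(2 / d) ^ m = 2 ^ m / (d\<^sup>2 * d ^ (m - 2))"
        using m le_add_diff_inverse[of 2 m] by (metis power_add power_divide)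
      then show ?thesis using d by (simp add: power_mult_distrib)
    qed
    finally have "ennreal ((real m - 1) / pi * (1 - (norm \<zeta>)\<^sup>2) ^ (m - 2) * ((2 / d) ^ m / s))
        \<le> ennreal (?c * (1 / (d\<^sup>2 * s)))"
      by (rule ennreal_leI)
    also have "\<dots> = ennreal ?c * ennreal (1 / (d\<^sup>2 * s))" by (rule ennreal_mult'[OF c])
    finally have "ennreal ((real m - 1) / pi * (1 - (norm \<zeta>)\<^sup>2) ^ (m - 2) * ((2 / d) ^ m / s))
        \<le> ennreal ?c * ennreal (1 / (d\<^sup>2 * s))" .
    then show ?thesis using True by (simp add: disc_weight_def disc_kernel_def d_def s_def)
  qed (simp add: disc_weight_def)
  then have "(\<integral>\<^sup>+\<zeta>. ennreal (disc_weight m \<zeta> * (disc_kernel z \<zeta> ^ m / sqrt (1 - (norm \<zeta>)\<^sup>2))) \<partial>lborel)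
      \<le> (\<integral>\<^sup>+\<zeta>. ennreal ?c * ?F \<zeta> \<partial>lborel)"
    by (intro nn_integral_mono) blast
  also have "\<dots> = ennreal ?c * (\<integral>\<^sup>+\<zeta>. ?F \<zeta> \<partial>lborel)"
  proof (rule nn_integral_cmult)
    have [measurable]: "(\<lambda>\<zeta>. norm (1 - cnj \<zeta> * z)) \<in> borel_measurable borel"
      by (intro borel_measurable_continuous_onI continuous_intros)
    show "?F \<in> borel_measurable lborel" by measurable
  qed
  also have "\<dots> \<le> ennreal ?c * ennreal (2 * pi\<^sup>2 / sqrt (1 - (norm z)\<^sup>2))"
    by (intro mult_left_mono disc_schur_2 z) simp
  also have "\<dots> = ennreal (disc_schur_const m / sqrt (1 - (norm z)\<^sup>2))"
    using c by (simp add: disc_schur_const_def flip: ennreal_mult')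
  finally show ?thesis .
qed

section \<open>Product measures on the torus and the polydisc\<close>

lemma nn_integral_lborel_vec:
  fixes f :: "'a::euclidean_space ^ 'n \<Rightarrow> ennreal"
  assumes [measurable]: "f \<in> borel_measurable borel"
  shows "(\<integral>\<^sup>+x. f x \<partial>lborel) = (\<integral>\<^sup>+x. f (vec_lambda x) \<partial>(Pi\<^sub>M UNIV (\<lambda>_. lborel)))"
  by (subst lborel_vec, subst nn_integral_distr) auto

lemma nn_integral_lborel_vec_prod:
  fixes g :: "'n::finite \<Rightarrow> 'a::euclidean_space \<Rightarrow> ennreal"
  assumes [measurable]: "\<And>k. g k \<in> borel_measurable borel"
  shows "(\<integral>\<^sup>+x. (\<Prod>k\<in>UNIV. g k (x $ k)) \<partial>lborel) = (\<Prod>k\<in>UNIV. \<integral>\<^sup>+x. g k x \<partial>lborel)"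
proof -
  interpret product_sigma_finite "\<lambda>_::'n. lborel :: 'a measure" by standard
  have "(\<integral>\<^sup>+x. (\<Prod>k\<in>UNIV. g k (x $ k)) \<partial>lborel) =
      (\<integral>\<^sup>+x. (\<Prod>k\<in>UNIV. g k (x k)) \<partial>(Pi\<^sub>M UNIV (\<lambda>_::'n. lborel :: 'a measure)))"
    by (subst nn_integral_lborel_vec) auto
  also have "\<dots> = (\<Prod>k\<in>UNIV. \<integral>\<^sup>+x. g k x \<partial>lborel)"
    by (subst product_nn_integral_prod) auto
  finally show ?thesis .
qed

section \<open>Haar measure in angular coordinates\<close>

definition torus_param :: "real ^ 'n \<Rightarrow> complex ^ 'n" where
  "torus_param \<theta> = (\<chi> k. cis (\<theta> $ k))"

lemma torus_param_torus [simp]: "torus_param \<theta> \<in> torus"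
  by (simp add: torus_param_def torus_def)

lemma open_polydisc: "open (polydisc :: (complex ^ 'n::finite) set)"
proof -
  have eq: "polydisc = (\<Inter>k. {z :: complex ^ 'n. norm (z $ k) < 1})" by (auto simp: polydisc_def)
  show ?thesis unfolding eq by (intro open_INT ballI open_Collect_less continuous_intros) simp
qed

lemma sets_polydisc [measurable]: "(polydisc :: (complex ^ 'n::finite) set) \<in> sets borel"
  by (intro borel_open open_polydisc)

lemma measurable_torus_param_borel [measurable]: "(torus_param :: real ^ 'n::finite \<Rightarrow> _) \<in> borel_measurable borel"
  unfolding torus_param_def by (intro borel_measurable_continuous_onI continuous_intros)

lemma measurable_torus_param [measurable]:
  "(torus_param :: real ^ 'n::finite \<Rightarrow> _) \<in> borel \<rightarrow>\<^sub>M restrict_space borel torus"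
  by (intro measurable_restrict_space2) auto

text \<open>The uniform density on the cube is the product of the circle weights, both being
  constant on the cube and \<open>0\<close> off it. In this form integrals of products split over
  the coordinates.\<close>

lemma nn_integral_haar_torus:
  fixes f :: "complex ^ 'n::finite \<Rightarrow> ennreal"
  assumes [measurable]: "f \<in> borel_measurable (restrict_space borel torus)"
  shows "(\<integral>\<^sup>+w. f w \<partial>haar_torus) =
    (\<integral>\<^sup>+\<theta>. (\<Prod>k\<in>UNIV. ennreal (circle_weight (\<theta> $ k))) * f (torus_param \<theta>) \<partial>lborel)"
proof -
  let ?Q = "cbox 0 (\<chi> k. 2 * pi) :: (real ^ 'n) set"
  define c where "c = (\<Prod>k\<in>(UNIV :: 'n set). 2 * pi)"
  have c: "c > 0" by (simp add: c_def)
  have Q: "emeasure lborel ?Q = ennreal c"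
  proof -
    have "indicator ?Q x = (\<Prod>k\<in>UNIV. indicator {0..2*pi} (x $ k) :: ennreal)" for x
    proof (cases "x \<in> ?Q")
      case False
      then obtain k where "x $ k \<notin> {0..2*pi}" by (auto simp: mem_box_cart)
      then have "(\<Prod>k\<in>UNIV. indicator {0..2*pi} (x $ k) :: ennreal) = 0"
        by (intro prod_zero bexI[of _ k]) auto
      with False show ?thesis by simp
    qed (simp add: mem_box_cart)
    moreover have "emeasure lborel ?Q = (\<integral>\<^sup>+x. indicator ?Q x \<partial>lborel)" by simp
    ultimately have "emeasure lborel ?Q = (\<integral>\<^sup>+x. (\<Prod>k\<in>UNIV. indicator {0..2*pi} (x $ k)) \<partial>(lborel :: (real ^ 'n) measure))"
      by (simp only:)
    also have "\<dots> = (\<Prod>k\<in>(UNIV :: 'n set). \<integral>\<^sup>+x. indicator {0..2*pi} x \<partial>lborel)"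
      by (rule nn_integral_lborel_vec_prod) simp
    also have "\<dots> = ennreal c" by (simp add: c_def ennreal_power)
    finally show ?thesis .
  qed
  have "(\<integral>\<^sup>+w. f w \<partial>haar_torus) = (\<integral>\<^sup>+\<theta>. f (torus_param \<theta>) \<partial>uniform_measure lborel ?Q)"
    unfolding haar_torus_def torus_param_def[symmetric]
    by (rule nn_integral_distr) (simp_all cong: measurable_cong_sets)
  also have "\<dots> = (\<integral>\<^sup>+\<theta>. f (torus_param \<theta>) * indicator ?Q \<theta> \<partial>lborel) / ennreal c"
    unfolding Q[symmetric] by (rule nn_integral_uniform_measure) auto
  also have "\<dots> = (\<integral>\<^sup>+\<theta>. f (torus_param \<theta>) * indicator ?Q \<theta> / ennreal c \<partial>lborel)"
    by (rule nn_integral_divide[symmetric]) auto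
  also have "\<dots> = (\<integral>\<^sup>+\<theta>. (\<Prod>k\<in>UNIV. ennreal (circle_weight (\<theta> $ k))) * f (torus_param \<theta>) \<partial>lborel)"
  proof (rule nn_integral_cong)
    fix \<theta> :: "real ^ 'n"
    have "(\<Prod>k\<in>UNIV. ennreal (circle_weight (\<theta> $ k))) = indicator ?Q \<theta> / ennreal c"
    proof (cases "\<theta> \<in> ?Q")
      case True
      then have "circle_weight (\<theta> $ k) = 1 / (2 * pi)" for k
        by (simp add: mem_box_cart circle_weight_def)
      then have "(\<Prod>k\<in>UNIV. ennreal (circle_weight (\<theta> $ k))) = ennreal (\<Prod>k\<in>(UNIV :: 'n set). 1 / (2 * pi))"
        by (subst prod_ennreal) auto
      also have "(\<Prod>k\<in>(UNIV :: 'n set). 1 / (2 * pi)) = 1 / c" by (simp add: c_def power_divide)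
      also have "ennreal (1 / c) = 1 / ennreal c" using c by (simp add: divide_ennreal flip: ennreal_1)
      finally show ?thesis using True by simp
    next
      case False
      then obtain k where "\<theta> $ k \<notin> {0..2*pi}" by (auto simp: mem_box_cart)
      then have "circle_weight (\<theta> $ k) = 0" by (simp add: circle_weight_def)
      then have "(\<Prod>k\<in>UNIV. ennreal (circle_weight (\<theta> $ k))) = 0" by (metis UNIV_I ennreal_0 finite_class.finite_UNIV prod_zero)
      with False show ?thesis by simp
    qed
    then show "f (torus_param \<theta>) * indicator ?Q \<theta> / ennreal c
        = (\<Prod>k\<in>UNIV. ennreal (circle_weight (\<theta> $ k))) * f (torus_param \<theta>)"
      by (simp add: ennreal_times_divide mult.commute)
  qed
  finally show ?thesis .
qed

lemma nn_integral_haar_torus_prod: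
  fixes g :: "'n::finite \<Rightarrow> complex \<Rightarrow> ennreal"
  assumes [measurable]: "\<And>k. g k \<in> borel_measurable borel"
  shows "(\<integral>\<^sup>+w. (\<Prod>k\<in>UNIV. g k (w $ k)) \<partial>haar_torus) =
    (\<Prod>k\<in>UNIV. \<integral>\<^sup>+t. ennreal (circle_weight t) * g k (cis t) \<partial>lborel)"
proof -
  have "(\<integral>\<^sup>+w. (\<Prod>k\<in>UNIV. g k (w $ k)) \<partial>haar_torus) =
      (\<integral>\<^sup>+\<theta>. (\<Prod>k\<in>UNIV. ennreal (circle_weight (\<theta> $ k))) * (\<Prod>k\<in>UNIV. g k (torus_param \<theta> $ k)) \<partial>lborel)"
    by (rule nn_integral_haar_torus) (intro measurable_restrict_space1, measurable)
  also have "\<dots> = (\<integral>\<^sup>+\<theta>. (\<Prod>k\<in>UNIV. ennreal (circle_weight (\<theta> $ k)) * g k (cis (\<theta> $ k))) \<partial>lborel)"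
    by (simp add: prod.distrib torus_param_def)
  also have "\<dots> = (\<Prod>k\<in>UNIV. \<integral>\<^sup>+t. ennreal (circle_weight t) * g k (cis t) \<partial>lborel)"
    by (rule nn_integral_lborel_vec_prod[of "\<lambda>k t. ennreal (circle_weight t) * g k (cis t)"]) measurable
  finally show ?thesis .
qed

section \<open>The Bergman measure as a product\<close>

lemma space_bergman_measure [simp]: "space (bergman_measure m) = polydisc"
  by (simp add: bergman_measure_def)

lemma sets_bergman_measure [measurable_cong]:
  "sets (bergman_measure m :: (complex ^ 'n::finite) measure) = sets (restrict_space borel polydisc)"
  by (simp add: bergman_measure_def sets_restrict_space)

lemma space_haar_torus [simp]: "space haar_torus = torus"
  by (simp add: haar_torus_def space_restrict_space)

lemma sets_haar_torus [measurable_cong]: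
  "sets (haar_torus :: (complex ^ 'n::finite) measure) = sets (restrict_space borel torus)"
  by (simp add: haar_torus_def)

text \<open>On the polydisc the product of the one-variable weights is the density; off it some
  coordinate has norm at least \<open>1\<close> and its weight vanishes. The restriction of the
  domain thus becomes part of the integrand.\<close>

lemma nn_integral_bergman_measure:
  fixes f :: "complex ^ 'n::finite \<Rightarrow> ennreal"
  assumes m: "m \<ge> 2" and [measurable]: "f \<in> borel_measurable (restrict_space borel polydisc)"
  shows "(\<integral>\<^sup>+z. f z \<partial>bergman_measure m) =
    (\<integral>\<^sup>+z. (\<Prod>k\<in>UNIV. ennreal (disc_weight m (z $ k))) * f z \<partial>lborel)"
proof -
  let ?w = "\<lambda>z :: complex ^ 'n. (real m - 1) ^ CARD('n) / pi ^ CARD('n) *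
                      (\<Prod>k\<in>UNIV. (1 - (norm (z $ k))\<^sup>2) ^ (m - 2))"
  have w: "?w \<in> borel_measurable borel"
    by (intro borel_measurable_continuous_onI continuous_intros) simp
  have r: "restrict_space lborel polydisc \<rightarrow>\<^sub>M N = restrict_space borel polydisc \<rightarrow>\<^sub>M N" for N :: "'c measure"
    by (intro measurable_cong_sets) (simp_all add: sets_restrict_space)
  have "(\<integral>\<^sup>+z. f z \<partial>bergman_measure m) = (\<integral>\<^sup>+z. ennreal (?w z) * f z \<partial>restrict_space lborel polydisc)"
    unfolding bergman_measure_def
    by (rule nn_integral_density) (use measurable_compose[OF w measurable_ennreal] assms in \<open>auto simp: r intro!: measurable_restrict_space1\<close>)
  also have "\<dots> = (\<integral>\<^sup>+z. ennreal (?w z) * f z * indicator polydisc z \<partial>lborel)"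
    by (rule nn_integral_restrict_space) simp
  also have "\<dots> = (\<integral>\<^sup>+z. (\<Prod>k\<in>UNIV. ennreal (disc_weight m (z $ k))) * f z \<partial>lborel)"
  proof (rule nn_integral_cong)
    fix z :: "complex ^ 'n"
    show "ennreal (?w z) * f z * indicator polydisc z = (\<Prod>k\<in>UNIV. ennreal (disc_weight m (z $ k))) * f z"
    proof (cases "z \<in> polydisc")
      case True
      then have "(\<Prod>k\<in>UNIV. disc_weight m (z $ k)) = ?w z"
        by (simp add: polydisc_def disc_weight_def prod.distrib prod_dividef)
      moreover have "(\<Prod>k\<in>UNIV. ennreal (disc_weight m (z $ k))) = ennreal (\<Prod>k\<in>UNIV. disc_weight m (z $ k))"
        using m by (intro prod_ennreal) (simp add: disc_weight_nonneg)
      ultimately show ?thesis using True by simp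
    next
      case False
      then obtain k where "\<not> norm (z $ k) < 1" by (auto simp: polydisc_def)
      then have "disc_weight m (z $ k) = 0" by (simp add: disc_weight_def)
      then have "(\<Prod>k\<in>UNIV. ennreal (disc_weight m (z $ k))) = 0"
        by (metis UNIV_I ennreal_0 finite_class.finite_UNIV prod_zero)
      with False show ?thesis by simp
    qed
  qed
  finally show ?thesis .
qed

lemma nn_integral_bergman_measure_prod:
  fixes g :: "'n::finite \<Rightarrow> complex \<Rightarrow> ennreal"
  assumes m: "m \<ge> 2" and [measurable]: "\<And>k. g k \<in> borel_measurable borel"
  shows "(\<integral>\<^sup>+z. (\<Prod>k\<in>UNIV. g k (z $ k)) \<partial>bergman_measure m) =
    (\<Prod>k\<in>UNIV. \<integral>\<^sup>+z. ennreal (disc_weight m z) * g k z \<partial>lborel)"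
proof -
  have "(\<integral>\<^sup>+z. (\<Prod>k\<in>UNIV. g k (z $ k)) \<partial>bergman_measure m) =
      (\<integral>\<^sup>+z. (\<Prod>k\<in>UNIV. ennreal (disc_weight m (z $ k)) * g k (z $ k)) \<partial>lborel)"
    by (subst nn_integral_bergman_measure[OF m])
      (auto simp: prod.distrib intro!: measurable_restrict_space1)
  also have "\<dots> = (\<Prod>k\<in>UNIV. \<integral>\<^sup>+z. ennreal (disc_weight m z) * g k z \<partial>lborel)"
    by (rule nn_integral_lborel_vec_prod[of "\<lambda>k z. ennreal (disc_weight m z) * g k z"]) measurable
  finally show ?thesis .
qed

lemma emeasure_bergman_measure_polydisc:
  assumes "m \<ge> 2"
  shows "emeasure (bergman_measure m) (polydisc :: (complex ^ 'n::finite) set) = 1"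
proof -
  have "emeasure (bergman_measure m) (space (bergman_measure m :: (complex ^ 'n::finite) measure))
      = (\<integral>\<^sup>+z. (\<Prod>k\<in>(UNIV :: 'n set). 1) \<partial>(bergman_measure m :: (complex ^ 'n) measure))" by simp
  also have "\<dots> = 1"
    by (subst nn_integral_bergman_measure_prod[OF assms]) (simp_all add: nn_integral_disc_weight assms)
  finally show ?thesis by (simp only: space_bergman_measure)
qed

section \<open>The Schur test and the \<open>T T*\<close> method\<close>

text \<open>One summand alone suffices: the first if \<open>y <= x * r\<close>, the second
  otherwise. The case split avoids subtraction, which is truncated on
  \<open>ennreal\<close>.\<close>

lemma ennreal_weighted_am_gm:
  fixes x y r :: ennreal
  assumes "r \<noteq> 0" "r \<noteq> \<infinity>"
  shows "x * y \<le> x\<^sup>2 * r + y\<^sup>2 / r"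
proof (cases "y \<le> x * r")
  case True
  then have "x * y \<le> x * (x * r)" by (intro mult_left_mono) auto
  then show ?thesis by (simp add: power2_eq_square mult.assoc add_increasing2)
next
  case False
  then have "x * r / r \<le> y / r" by (intro divide_right_mono_ennreal) simp
  then have "x \<le> y / r" using assms by (simp add: ennreal_mult_divide_eq)
  then have "x * y \<le> y / r * y" by (intro mult_right_mono) auto
  also have "\<dots> = y\<^sup>2 / r" by (simp add: power2_eq_square ennreal_times_divide mult.commute)
  finally show ?thesis by (simp add: add_increasing)
qed

text \<open>Here \<open>c\<close> plays the role of \<open>1 / t\<close>. If
  \<open>k <= t * x\<close> the first summand dominates; otherwise \<open>x <= c * k\<close>, and
  \<open>m - 1\<close> factors \<open>x\<close> are traded for \<open>c * k\<close>. A kernel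
  \<open>k\<close> is thereby replaced by \<open>k ^ m\<close> at the price of a term that can be
  absorbed later.\<close>

lemma ennreal_young:
  fixes x k c t :: ennreal
  assumes ct: "c * t = 1" and m: "m \<ge> 1"
  shows "x ^ (2 * m - 1) * k \<le> t * x ^ (2 * m) + c ^ (m - 1) * (k ^ m * x ^ m)"
proof (cases "k \<le> t * x")
  case True
  then have "x ^ (2 * m - 1) * k \<le> x ^ (2 * m - 1) * (t * x)" by (intro mult_left_mono) auto
  also have "\<dots> = t * x ^ Suc (2 * m - 1)" by (simp add: mult_ac)
  also have "Suc (2 * m - 1) = 2 * m" using m by simp
  finally show ?thesis by (simp add: add_increasing2)
next
  case False
  then have "c * (t * x) \<le> c * k" by (intro mult_left_mono) auto
  then have "x \<le> c * k" using ct by (simp flip: mult.assoc)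
  then have "x ^ (m - 1) \<le> c ^ (m - 1) * k ^ (m - 1)"
    by (metis power_mono power_mult_distrib zero_le)
  then have "x ^ m * (x ^ (m - 1) * k) \<le> x ^ m * (c ^ (m - 1) * k ^ (m - 1) * k)"
    by (intro mult_left_mono mult_right_mono) auto
  moreover have "x ^ (2 * m - 1) = x ^ m * x ^ (m - 1)" using m by (simp flip: power_add add: mult_2)
  moreover have "k ^ m = k ^ (m - 1) * k" using m by (metis Suc_diff_1 less_le_trans power_Suc2 zero_less_one)
  ultimately have "x ^ (2 * m - 1) * k \<le> c ^ (m - 1) * (k ^ m * x ^ m)" by (simp add: mult_ac)
  then show ?thesis by (simp add: add_increasing)
qed

(* The constant comes from choosing t = 1 / (2 S). *)
lemma absorb_quadratic:
  fixes A S C :: real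
  assumes A: "A \<ge> 0" and S: "S \<ge> 0" and C: "C \<ge> 0" and m: "m \<ge> 1"
    and *: "\<And>t. t > 0 \<Longrightarrow> A\<^sup>2 \<le> S * (t * A\<^sup>2 + (1 / t) ^ (m - 1) * (C * A))"
  shows "A \<le> 2 ^ m * C * S ^ m"
proof (cases "A = 0 \<or> S = 0")
  case True
  with *[of 1] C S show ?thesis by auto
next
  case False
  with A S have pos: "A > 0" "S > 0" by auto
  have "A\<^sup>2 \<le> S * (1 / (2 * S) * A\<^sup>2 + (1 / (1 / (2 * S))) ^ (m - 1) * (C * A))"
    using pos by (intro *) simp
  also have "\<dots> = A\<^sup>2 / 2 + (S * (2 * S) ^ (m - 1)) * (C * A)"
    using pos by (simp add: field_simps)
  finally have "A * A \<le> (2 * S * (2 * S) ^ (m - 1)) * C * A" by (simp add: power2_eq_square)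
  then have "A \<le> (2 * S * (2 * S) ^ (m - 1)) * C" using pos(1) by (simp only: mult_le_cancel_right_pos)
  also have "2 * S * (2 * S) ^ (m - 1) = (2 * S) ^ m" using m by (metis Suc_diff_1 less_le_trans power_Suc zero_less_one)
  finally show ?thesis by (simp add: power_mult_distrib mult_ac)
qed

text \<open>In the application \<open>M\<close> is the Bergman measure, \<open>T\<close> the Haar
  measure, \<open>P\<close> the Poisson kernel, and \<open>u\<close> and \<open>v\<close> are one
  function seen on the polydisc and on the torus. \<open>PK\<close> bounds the kernel of the
  operator \<open>P\<close> composed with its adjoint, and \<open>Kh\<close> is Schur's condition on
  \<open>K ^ m\<close> with test function \<open>h\<close>.\<close>

context
  fixes M :: "'a measure" and T :: "'b measure"
    and P :: "'a \<Rightarrow> 'b \<Rightarrow> ennreal" and K :: "'a \<Rightarrow> 'a \<Rightarrow> ennreal" and h u :: "'a \<Rightarrow> ennreal"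
    and v :: "'b \<Rightarrow> ennreal" and C :: ennreal and m :: nat
  assumes sigma_finite: "sigma_finite_measure M" "sigma_finite_measure T"
    and P[measurable]: "(\<lambda>(z, w). P z w) \<in> borel_measurable (M \<Otimes>\<^sub>M T)"
    and K[measurable]: "(\<lambda>(z, w). K z w) \<in> borel_measurable (M \<Otimes>\<^sub>M M)"
    and [measurable]: "h \<in> borel_measurable M" "u \<in> borel_measurable M" "v \<in> borel_measurable T"
    and h: "\<And>z. z \<in> space M \<Longrightarrow> h z \<noteq> 0 \<and> h z \<noteq> \<infinity>"
    and K_commute: "\<And>z \<zeta>. K z \<zeta> = K \<zeta> z"
    and uP: "\<And>z. z \<in> space M \<Longrightarrow> u z \<le> (\<integral>\<^sup>+w. P z w * v w \<partial>T)"
    and PK: "\<And>z \<zeta>. z \<in> space M \<Longrightarrow> \<zeta> \<in> space M \<Longrightarrow> (\<integral>\<^sup>+w. P z w * P \<zeta> w \<partial>T) \<le> K z \<zeta>"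
    and Kh: "\<And>z. z \<in> space M \<Longrightarrow> (\<integral>\<^sup>+\<zeta>. K z \<zeta> ^ m * h \<zeta> \<partial>M) \<le> C * h z"
    and m: "m \<ge> 1"
begin

interpretation M: sigma_finite_measure M by (rule sigma_finite)
interpretation T: sigma_finite_measure T by (rule sigma_finite)
interpretation MT: pair_sigma_finite M T ..
interpretation MM: pair_sigma_finite M M ..

text \<open>Schur's test in quadratic form: the mixed product is split into two squares weighted by
  ratios of \<open>h\<close>, one integration is then the Schur condition, and the symmetry of
  \<open>K\<close> makes the two halves equal.\<close>

lemma schur_test_double_integral:
  "(\<integral>\<^sup>+z. \<integral>\<^sup>+\<zeta>. K z \<zeta> ^ m * (u z * u \<zeta>) ^ m \<partial>M \<partial>M) \<le> 2 * C * (\<integral>\<^sup>+z. u z ^ (2 * m) \<partial>M)"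
proof -
  let ?f = "\<lambda>z \<zeta>. u z ^ (2 * m) / h z * (K z \<zeta> ^ m * h \<zeta>)"
  have "(\<integral>\<^sup>+z. \<integral>\<^sup>+\<zeta>. K z \<zeta> ^ m * (u z * u \<zeta>) ^ m \<partial>M \<partial>M)
      \<le> (\<integral>\<^sup>+z. \<integral>\<^sup>+\<zeta>. ?f z \<zeta> + ?f \<zeta> z \<partial>M \<partial>M)"
  proof (intro nn_integral_mono)
    fix z \<zeta> assume "z \<in> space M" "\<zeta> \<in> space M"
    then have hh: "h z \<noteq> 0" "h z \<noteq> \<infinity>" "h \<zeta> \<noteq> 0" "h \<zeta> \<noteq> \<infinity>" using h by auto
    \<comment> \<open>With this ratio the first square carries \<open>h \<zeta> / h z\<close>, so
      its integral over \<open>\<zeta>\<close> is the one estimated by \<open>Kh\<close>. The second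
      square is the first with \<open>z\<close> and \<open>\<zeta>\<close> exchanged.\<close>
    define r where "r = h \<zeta> / h z"
    have r: "r \<noteq> 0" "r \<noteq> \<infinity>"
      using hh by (auto simp: r_def ennreal_divide_eq_top_iff ennreal_divide_eq_0_iff)
    obtain a b where ab: "h z = ennreal a" "h \<zeta> = ennreal b" "a > 0" "b > 0"
      using hh by (metis ennreal_cases ennreal_eq_0_iff infinity_ennreal_def not_le)
    then have "inverse r = h z / h \<zeta>"
      by (simp add: r_def divide_ennreal inverse_ennreal)
    then have r': "y / r = y * (h z / h \<zeta>)" for y
      by (simp only: divide_ennreal_def)
    have "u z ^ m * u \<zeta> ^ m \<le> (u z ^ m)\<^sup>2 * r + (u \<zeta> ^ m)\<^sup>2 / r"
      by (rule ennreal_weighted_am_gm) (fact r)+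
    also have "\<dots> = u z ^ (2 * m) * (h \<zeta> / h z) + u \<zeta> ^ (2 * m) * (h z / h \<zeta>)"
      unfolding r' by (simp add: r_def power_even_eq)
    finally have "K z \<zeta> ^ m * (u z * u \<zeta>) ^ m \<le> K z \<zeta> ^ m * \<dots>"
      by (intro mult_left_mono) (auto simp: power_mult_distrib)
    also have "\<dots> = ?f z \<zeta> + ?f \<zeta> z"
      by (simp add: distrib_left K_commute[of \<zeta> z] divide_ennreal_def mult_ac)
    finally show "K z \<zeta> ^ m * (u z * u \<zeta>) ^ m \<le> ?f z \<zeta> + ?f \<zeta> z" .
  qed
  also have "\<dots> = (\<integral>\<^sup>+z. \<integral>\<^sup>+\<zeta>. ?f z \<zeta> \<partial>M \<partial>M) + (\<integral>\<^sup>+z. \<integral>\<^sup>+\<zeta>. ?f \<zeta> z \<partial>M \<partial>M)"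
    by (simp add: nn_integral_add cong: nn_integral_cong)
  also have "(\<integral>\<^sup>+z. \<integral>\<^sup>+\<zeta>. ?f \<zeta> z \<partial>M \<partial>M) = (\<integral>\<^sup>+z. \<integral>\<^sup>+\<zeta>. ?f z \<zeta> \<partial>M \<partial>M)"
    by (rule MM.Fubini') measurable
  also have "(\<integral>\<^sup>+z. \<integral>\<^sup>+\<zeta>. ?f z \<zeta> \<partial>M \<partial>M) \<le> (\<integral>\<^sup>+z. C * u z ^ (2 * m) \<partial>M)"
  proof (intro nn_integral_mono)
    fix z assume z: "z \<in> space M"
    have "(\<integral>\<^sup>+\<zeta>. ?f z \<zeta> \<partial>M) = u z ^ (2 * m) / h z * (\<integral>\<^sup>+\<zeta>. K z \<zeta> ^ m * h \<zeta> \<partial>M)"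
      using z by (intro nn_integral_cmult) measurable
    also have "\<dots> \<le> u z ^ (2 * m) / h z * (C * h z)"
      by (intro mult_left_mono Kh z) simp
    also have "\<dots> = C * u z ^ (2 * m) * (h z / h z)"
      by (simp add: divide_ennreal_def mult_ac)
    also have "\<dots> = C * u z ^ (2 * m)" using h[OF z] by (simp add: ennreal_divide_self less_top)
    finally show "(\<integral>\<^sup>+\<zeta>. ?f z \<zeta> \<partial>M) \<le> C * u z ^ (2 * m)" .
  qed
  also have "(\<integral>\<^sup>+z. C * u z ^ (2 * m) \<partial>M) = C * (\<integral>\<^sup>+z. u z ^ (2 * m) \<partial>M)"
    by (rule nn_integral_cmult) measurable
  finally show ?thesis
    by (simp add: mult_2 distrib_right add_mono)
qed

text \<open>One factor \<open>u\<close> of \<open>u ^ (2 * m)\<close> is replaced by its majorant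
  from \<open>uP\<close>, and Fubini moves the operator onto \<open>u ^ (2 * m - 1)\<close>.
  Cauchy-Schwarz in \<open>w\<close> splits off \<open>v\<close>, and the square of the adjoint
  image is a double integral whose kernel is bounded by \<open>PK\<close>.\<close>

lemma TT_star_double_integral:
  "(\<integral>\<^sup>+z. u z ^ (2 * m) \<partial>M)\<^sup>2 \<le>
     (\<integral>\<^sup>+w. (v w)\<^sup>2 \<partial>T) * (\<integral>\<^sup>+z. \<integral>\<^sup>+\<zeta>. (u z * u \<zeta>) ^ (2 * m - 1) * K z \<zeta> \<partial>M \<partial>M)"
proof -
  define \<phi> where "\<phi> z = u z ^ (2 * m - 1)" for z
  have [measurable]: "\<phi> \<in> borel_measurable M" unfolding \<phi>_def by measurable
  \<comment> \<open>The adjoint operator applied to \<open>\<phi>\<close>.\<close>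
  define Q where "Q w = (\<integral>\<^sup>+z. P z w * \<phi> z \<partial>M)" for w
  have [measurable]: "Q \<in> borel_measurable T" unfolding Q_def by measurable
  have "u z ^ (2 * m) = \<phi> z * u z" for z
    using m by (simp add: \<phi>_def flip: power_Suc2)
  then have "(\<integral>\<^sup>+z. u z ^ (2 * m) \<partial>M) \<le> (\<integral>\<^sup>+z. \<phi> z * (\<integral>\<^sup>+w. P z w * v w \<partial>T) \<partial>M)"
    by (auto intro!: nn_integral_mono mult_left_mono uP)
  also have "\<dots> = (\<integral>\<^sup>+z. \<integral>\<^sup>+w. \<phi> z * (P z w * v w) \<partial>T \<partial>M)"
    by (intro nn_integral_cong nn_integral_cmult[symmetric]) measurable
  also have "\<dots> = (\<integral>\<^sup>+w. \<integral>\<^sup>+z. \<phi> z * (P z w * v w) \<partial>M \<partial>T)"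
    by (rule MT.Fubini'[symmetric]) measurable
  also have "\<dots> = (\<integral>\<^sup>+w. \<integral>\<^sup>+z. v w * (P z w * \<phi> z) \<partial>M \<partial>T)"
    by (simp add: mult_ac)
  also have "\<dots> = (\<integral>\<^sup>+w. v w * Q w \<partial>T)"
    unfolding Q_def by (intro nn_integral_cong nn_integral_cmult) measurable
  finally have "(\<integral>\<^sup>+z. u z ^ (2 * m) \<partial>M)\<^sup>2 \<le> (\<integral>\<^sup>+w. v w * Q w \<partial>T)\<^sup>2"
    by (rule power_mono) simp
  also have "\<dots> \<le> (\<integral>\<^sup>+w. (v w)\<^sup>2 \<partial>T) * (\<integral>\<^sup>+w. (Q w)\<^sup>2 \<partial>T)"
    by (rule Cauchy_Schwarz_nn_integral) measurable
  also have "(\<integral>\<^sup>+w. (Q w)\<^sup>2 \<partial>T) = (\<integral>\<^sup>+w. \<integral>\<^sup>+z. \<integral>\<^sup>+\<zeta>. (P z w * \<phi> z) * (P \<zeta> w * \<phi> \<zeta>) \<partial>M \<partial>M \<partial>T)"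
  proof (rule nn_integral_cong)
    fix w assume [measurable]: "w \<in> space T"
    have "(Q w)\<^sup>2 = (\<integral>\<^sup>+z. (P z w * \<phi> z) * Q w \<partial>M)"
      unfolding power2_eq_square by (subst Q_def, rule nn_integral_multc[symmetric]) measurable
    also have "\<dots> = (\<integral>\<^sup>+z. \<integral>\<^sup>+\<zeta>. (P z w * \<phi> z) * (P \<zeta> w * \<phi> \<zeta>) \<partial>M \<partial>M)"
      unfolding Q_def by (intro nn_integral_cong nn_integral_cmult[symmetric]) measurable
    finally show "(Q w)\<^sup>2 = \<dots>" .
  qed
  \<comment> \<open>Two exchanges bring the integral over \<open>w\<close> to the innermost place,
    where \<open>PK\<close> applies.\<close>
  also have "\<dots> = (\<integral>\<^sup>+z. \<integral>\<^sup>+w. \<integral>\<^sup>+\<zeta>. (P z w * \<phi> z) * (P \<zeta> w * \<phi> \<zeta>) \<partial>M \<partial>T \<partial>M)"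
    by (rule MT.Fubini') measurable
  also have "\<dots> = (\<integral>\<^sup>+z. \<integral>\<^sup>+\<zeta>. \<integral>\<^sup>+w. (P z w * \<phi> z) * (P \<zeta> w * \<phi> \<zeta>) \<partial>T \<partial>M \<partial>M)"
    by (intro nn_integral_cong MT.Fubini') measurable
  also have "\<dots> \<le> (\<integral>\<^sup>+z. \<integral>\<^sup>+\<zeta>. (u z * u \<zeta>) ^ (2 * m - 1) * K z \<zeta> \<partial>M \<partial>M)"
  proof (intro nn_integral_mono)
    fix z \<zeta> assume z[measurable]: "z \<in> space M" and \<zeta>[measurable]: "\<zeta> \<in> space M"
    have "(\<integral>\<^sup>+w. (P z w * \<phi> z) * (P \<zeta> w * \<phi> \<zeta>) \<partial>T) = (\<integral>\<^sup>+w. \<phi> z * \<phi> \<zeta> * (P z w * P \<zeta> w) \<partial>T)"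
      by (simp add: mult_ac)
    also have "\<dots> = \<phi> z * \<phi> \<zeta> * (\<integral>\<^sup>+w. P z w * P \<zeta> w \<partial>T)"
      by (rule nn_integral_cmult) measurable
    also have "\<dots> \<le> \<phi> z * \<phi> \<zeta> * K z \<zeta>" by (intro mult_left_mono PK z \<zeta>) simp
    finally show "(\<integral>\<^sup>+w. (P z w * \<phi> z) * (P \<zeta> w * \<phi> \<zeta>) \<partial>T) \<le> (u z * u \<zeta>) ^ (2 * m - 1) * K z \<zeta>"
      by (simp add: \<phi>_def power_mult_distrib)
  qed
  finally show ?thesis by (simp add: mult_left_mono)
qed

text \<open>Write \<open>A\<close> for the left side and \<open>S\<close> for the integral of the
  square of \<open>v\<close>. The two double integral bounds and Young's inequality give
  \<open>A^2 <= S * (t * A^2 + (1 / t) ^ (m - 1) * 2 * C * A)\<close> for every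
  \<open>t > 0\<close>. The finiteness of \<open>A\<close> permits absorbing its square.\<close>

lemma schur_TT_star:
  assumes A: "(\<integral>\<^sup>+z. u z ^ (2 * m) \<partial>M) < \<infinity>" and S: "(\<integral>\<^sup>+w. (v w)\<^sup>2 \<partial>T) < \<infinity>" and C: "C < \<infinity>"
  shows "(\<integral>\<^sup>+z. u z ^ (2 * m) \<partial>M) \<le> 2 ^ Suc m * C * (\<integral>\<^sup>+w. (v w)\<^sup>2 \<partial>T) ^ m"
proof -
  obtain a where a: "(\<integral>\<^sup>+z. u z ^ (2 * m) \<partial>M) = ennreal a" "a \<ge> 0" using A by (cases "\<integral>\<^sup>+z. u z ^ (2 * m) \<partial>M") auto
  obtain s where s: "(\<integral>\<^sup>+w. (v w)\<^sup>2 \<partial>T) = ennreal s" "s \<ge> 0" using S by (cases "\<integral>\<^sup>+w. (v w)\<^sup>2 \<partial>T") auto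
  obtain c where c: "C = ennreal c" "c \<ge> 0" using C by (cases C) auto
  have "a \<le> 2 ^ m * (2 * c) * s ^ m"
  proof (rule absorb_quadratic[OF a(2) s(2) _ m])
    fix t :: real assume t: "t > 0"
    have ct: "ennreal (1 / t) * ennreal t = 1" using t by (simp flip: ennreal_mult')
    have "(\<integral>\<^sup>+z. \<integral>\<^sup>+\<zeta>. (u z * u \<zeta>) ^ (2 * m - 1) * K z \<zeta> \<partial>M \<partial>M)
      \<le> (\<integral>\<^sup>+z. \<integral>\<^sup>+\<zeta>. ennreal t * (u z * u \<zeta>) ^ (2 * m)
            + ennreal (1 / t) ^ (m - 1) * (K z \<zeta> ^ m * (u z * u \<zeta>) ^ m) \<partial>M \<partial>M)"
      by (intro nn_integral_mono ennreal_young ct m)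
    also have "\<dots> = ennreal t * (\<integral>\<^sup>+z. \<integral>\<^sup>+\<zeta>. (u z * u \<zeta>) ^ (2 * m) \<partial>M \<partial>M)
        + ennreal (1 / t) ^ (m - 1) * (\<integral>\<^sup>+z. \<integral>\<^sup>+\<zeta>. K z \<zeta> ^ m * (u z * u \<zeta>) ^ m \<partial>M \<partial>M)"
      by (simp add: nn_integral_add nn_integral_cmult cong: nn_integral_cong)
    also have "(\<integral>\<^sup>+z. \<integral>\<^sup>+\<zeta>. (u z * u \<zeta>) ^ (2 * m) \<partial>M \<partial>M) = (\<integral>\<^sup>+z. u z ^ (2 * m) \<partial>M)\<^sup>2"
      by (simp add: power_mult_distrib nn_integral_cmult nn_integral_multc power2_eq_square)
    also have "ennreal t * (\<integral>\<^sup>+z. u z ^ (2 * m) \<partial>M)\<^sup>2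
        + ennreal (1 / t) ^ (m - 1) * (\<integral>\<^sup>+z. \<integral>\<^sup>+\<zeta>. K z \<zeta> ^ m * (u z * u \<zeta>) ^ m \<partial>M \<partial>M)
       \<le> ennreal t * (ennreal a)\<^sup>2 + ennreal (1 / t) ^ (m - 1) * (2 * ennreal c * ennreal a)"
      using schur_test_double_integral by (intro add_mono mult_left_mono) (simp_all add: a c)
    finally have "(\<integral>\<^sup>+z. u z ^ (2 * m) \<partial>M)\<^sup>2 \<le> ennreal s *
        (ennreal t * (ennreal a)\<^sup>2 + ennreal (1 / t) ^ (m - 1) * (2 * ennreal c * ennreal a))"
      using TT_star_double_integral unfolding s by (meson mult_left_mono order_trans zero_le)
    also have "\<dots> = ennreal (s * (t * a\<^sup>2 + (1 / t) ^ (m - 1) * (2 * c * a)))"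
      using t a(2) s(2) c(2)
      by (simp add: ennreal_power ennreal_numeral[symmetric] del: ennreal_numeral flip: ennreal_mult ennreal_plus)
    finally show "a\<^sup>2 \<le> s * (t * a\<^sup>2 + (1 / t) ^ (m - 1) * (2 * c * a))"
      using t a(2) s(2) c(2) by (simp add: a(1) ennreal_power)
  qed (use c in simp)
  then have "ennreal a \<le> ennreal (2 ^ m * (2 * c) * s ^ m)" by (rule ennreal_leI)
  also have "\<dots> = 2 ^ Suc m * C * ennreal s ^ m"
    using c s(2) by (simp add: ennreal_power ennreal_mult mult_ac flip: ennreal_numeral ennreal_power)
  finally show ?thesis by (simp add: a s)
qed

end

section \<open>Poisson integrals of pluriharmonic functions\<close>

text \<open>A real linear \<open>D\<close> with this property agrees with multiplication by
  \<open>D 1\<close> on the real basis \<open>1\<close>, \<i>.\<close>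

lemma has_field_derivative_if_Cauchy_Riemann:
  fixes g :: "complex \<Rightarrow> complex"
  assumes D: "(g has_derivative D) (at w)" and CR: "D \<i> = \<i> * D 1"
  shows "(g has_field_derivative D 1) (at w)"
proof -
  have lin: "linear D" using D by (rule has_derivative_linear)
  have "D v = D 1 * v" for v
  proof -
    have "D v = D (Re v *\<^sub>R 1 + Im v *\<^sub>R \<i>)"
      by (metis Complex_eq complex_surj mult.commute of_real_def scaleR_conv_of_real)
    also have "\<dots> = Re v *\<^sub>R D 1 + Im v *\<^sub>R D \<i>"
      by (simp add: linear_add[OF lin] linear_scale[OF lin])
    also have "\<dots> = D 1 * (complex_of_real (Re v) + \<i> * complex_of_real (Im v))"
      by (simp add: CR scaleR_conv_of_real algebra_simps)
    finally show ?thesis by (simp add: complex_eq[symmetric])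
  qed
  then have "D = (*) (D 1)" by blast
  with D show ?thesis unfolding has_field_derivative_def by metis
qed

definition vec_upd :: "'a ^ 'n \<Rightarrow> 'n \<Rightarrow> 'a \<Rightarrow> 'a ^ 'n" where
  "vec_upd z k w = (\<chi> i. if i = k then w else z $ i)"

lemma has_derivative_scaled_slice:
  "((\<lambda>w. r *\<^sub>R vec_upd z k w) has_derivative (\<lambda>v. r *\<^sub>R axis k (v::complex))) (at w)"
proof -
  have eq: "(\<lambda>w. r *\<^sub>R vec_upd z k w) = (\<lambda>w. r *\<^sub>R vec_upd z k 0 + r *\<^sub>R axis k w)"
    by (simp add: fun_eq_iff vec_eq_iff vec_upd_def axis_def)
  have "bounded_linear (\<lambda>v::complex. r *\<^sub>R (axis k v :: complex ^ 'a))"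
    unfolding linear_conv_bounded_linear[symmetric]
    by (rule linearI) (simp_all add: vec_eq_iff axis_def algebra_simps)
  from has_derivative_add[OF has_derivative_const bounded_linear_imp_has_derivative[OF this]]
  show ?thesis by (subst eq) simp
qed

(* On a slice the conjugate of the antiholomorphic derivative is holomorphic; H is a multiple of its primitive. *)
lemma pluriharmonic_slice:
  fixes f :: "complex ^ 'n::finite \<Rightarrow> complex" and z :: "complex ^ 'n"
  assumes f: "pluriharmonic f" and r: "0 < r" "r < 1" and z: "\<And>i. i \<noteq> k \<Longrightarrow> norm (z $ i) \<le> 1"
  obtains G H where "G holomorphic_on cball 0 1" "H holomorphic_on cball 0 1"
    "\<And>w. norm w \<le> 1 \<Longrightarrow> f (r *\<^sub>R vec_upd z k w) = G w + cnj (H w)"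
proof -
  \<comment> \<open>The dilated slice stays in the polydisc for \<open>norm w < 1 / r\<close>, and
    this disc is an open neighbourhood of the closed unit disc.\<close>
  define S where "S = ball (0::complex) (1 / r)"
  define e where "e w = r *\<^sub>R vec_upd z k w" for w
  define A where "A w = wirtinger_bar k f (e w)" for w
  have S: "open S" "convex S" by (auto simp: S_def)
  have sub: "cball 0 1 \<subseteq> S" using r by (simp add: S_def cball_subset_ball_iff)
  have eS: "e w \<in> polydisc" if "w \<in> S" for w
    unfolding polydisc_def
  proof (clarify)
    fix i
    show "norm (e w $ i) < 1"
    proof (cases "i = k")
      case True
      with that r show ?thesis by (simp add: e_def vec_upd_def S_def field_simps)
    next
      case False
      have "r * norm (z $ i) \<le> r * 1" using z[OF False] r by (intro mult_left_mono) auto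
      then have "r * norm (z $ i) < 1" using r by linarith
      with False r show ?thesis by (simp add: e_def vec_upd_def)
    qed
  qed
  have chain: "((\<lambda>w. g (e w)) has_derivative (\<lambda>v. r *\<^sub>R frechet_derivative g (at (e w)) (axis k v))) (at w)"
    if "g differentiable at (e w)" for g :: "complex ^ 'n \<Rightarrow> complex" and w
  proof -
    have gd: "(g has_derivative frechet_derivative g (at (e w))) (at (e w))"
      using that by (simp add: frechet_derivative_works)
    have "((\<lambda>w. g (e w)) has_derivative (\<lambda>v. frechet_derivative g (at (e w)) (r *\<^sub>R axis k v))) (at w)"
      unfolding e_def by (rule has_derivative_compose[OF has_derivative_scaled_slice gd[unfolded e_def]])
    then show ?thesis by (simp add: linear_scale[OF has_derivative_linear[OF gd]])
  qed
  from f have df: "f differentiable at x" if "x \<in> polydisc" for x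
    using that by (auto simp: pluriharmonic_def C2_on_def)
  have dw: "wirtinger_bar k f differentiable at x" if "x \<in> polydisc" for x
  proof -
    have "(\<lambda>y. frechet_derivative f (at y) v) differentiable at x" for v
      using f that by (auto simp: pluriharmonic_def C2_on_def)
    then have "(\<lambda>z. (frechet_derivative f (at z) (axis k 1) + \<i> * frechet_derivative f (at z) (axis k \<i>)) / 2) differentiable at x"
      by (intro differentiable_divide differentiable_add differentiable_mult differentiable_const) auto
    then show ?thesis unfolding wirtinger_bar_def[abs_def] .
  qed
  have Ahol: "(\<lambda>w. cnj (A w)) holomorphic_on S"
  proof (rule holomorphic_onI)
    fix w assume w: "w \<in> S"
    let ?D = "\<lambda>v. r *\<^sub>R frechet_derivative (wirtinger_bar k f) (at (e w)) (axis k v)"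
    have "(A has_derivative ?D) (at w)"
      unfolding A_def by (rule chain[OF dw[OF eS[OF w]]])
    then have D: "((\<lambda>w. cnj (A w)) has_derivative (\<lambda>v. cnj (?D v))) (at w)"
      by (rule has_derivative_cnj)
    \<comment> \<open>The diagonal equation says that \<open>A\<close> is antiholomorphic in
      \<open>w\<close>, which is the Cauchy-Riemann equation for its conjugate.\<close>
    have "wirtinger k (wirtinger_bar k f) (e w) = 0"
      using f eS[OF w] by (auto simp: pluriharmonic_def)
    then have "frechet_derivative (wirtinger_bar k f) (at (e w)) (axis k 1)
        = \<i> * frechet_derivative (wirtinger_bar k f) (at (e w)) (axis k \<i>)"
      by (simp add: wirtinger_def)
    then have "cnj (?D \<i>) = \<i> * cnj (?D 1)"
      by (simp add: scaleR_conv_of_real mult.left_commute[of \<i> "complex_of_real r"])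
    from has_field_derivative_if_Cauchy_Riemann[OF D this]
    show "(\<lambda>w. cnj (A w)) field_differentiable (at w within S)"
      using field_differentiable_at_within field_differentiable_def by blast
  qed
  obtain H0 where H0: "\<And>w. w \<in> S \<Longrightarrow> (H0 has_field_derivative cnj (A w)) (at w)"
    using holomorphic_convex_primitive'[OF S(2,1) Ahol] S(1) by (metis at_within_open)
  \<comment> \<open>The factor \<open>r\<close> comes from the chain rule for the dilation: the
    antiholomorphic derivative of \<open>f o e\<close> is \<open>r * A\<close>. That of
    \<open>cnj (H w)\<close> cancels it, so \<open>G\<close> satisfies the Cauchy-Riemann
    equation.\<close>
  define H where "H w = r * H0 w" for w
  have H: "(H has_field_derivative r * cnj (A w)) (at w)" if "w \<in> S" for w
    unfolding H_def using H0[OF that] by (rule DERIV_cmult)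
  define G where "G w = f (e w) - cnj (H w)" for w
  have "H holomorphic_on S"
    using H S(1) by (auto simp: holomorphic_on_open)
  moreover have "G holomorphic_on S"
  proof (rule holomorphic_onI)
    fix w assume w: "w \<in> S"
    let ?F = "frechet_derivative f (at (e w))"
    let ?D = "\<lambda>v. r *\<^sub>R ?F (axis k v) - cnj (r * cnj (A w) * v)"
    have "((\<lambda>w. f (e w)) has_derivative (\<lambda>v. r *\<^sub>R ?F (axis k v))) (at w)"
      by (rule chain[OF df[OF eS[OF w]]])
    moreover have "((\<lambda>w. cnj (H w)) has_derivative (\<lambda>v. cnj (r * cnj (A w) * v))) (at w)"
      using H[OF w] unfolding has_field_derivative_def by (rule has_derivative_cnj)
    ultimately have D: "(G has_derivative ?D) (at w)"
      unfolding G_def by (rule has_derivative_diff)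
    have "2 * A w = ?F (axis k 1) + \<i> * ?F (axis k \<i>)"
      by (simp add: A_def wirtinger_bar_def)
    then have F: "?F (axis k 1) = 2 * A w - \<i> * ?F (axis k \<i>)" by simp
    have "?D \<i> = \<i> * ?D 1" unfolding F by (simp add: scaleR_conv_of_real algebra_simps)
    from has_field_derivative_if_Cauchy_Riemann[OF D this]
    show "G field_differentiable (at w within S)"
      using field_differentiable_at_within field_differentiable_def by blast
  qed
  ultimately show ?thesis
    using that[of G H] sub by (auto simp: G_def e_def intro: holomorphic_on_subset)
qed

text \<open>The graph of a convex function lies above its tangent at \<open>a\<close>. Convexity is
  taken on the open half-line; at \<open>x = 0\<close> the left side is
  \<open>(1 - t) * a powr t\<close>, which is not positive.\<close>

lemma powr_above_tangent:
  fixes a x t :: real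
  assumes "a > 0" "x \<ge> 0" "t \<ge> 1"
  shows "a powr t + t * a powr (t - 1) * (x - a) \<le> x powr t"
proof (cases "x = 0")
  case True
  have "a powr (t - 1) * a = a powr t" using assms by (simp add: powr_mult_base powr_diff)
  then have "a powr t + t * a powr (t - 1) * (x - a) = (1 - t) * a powr t"
    using True by (simp add: algebra_simps)
  also have "\<dots> \<le> 0" using assms by (intro mult_nonpos_nonneg) auto
  finally show ?thesis by (rule order_trans) simp
next
  case False
  have "((\<lambda>x. x powr t) has_real_derivative t * a powr (t - 1)) (at a within {0<..})"
    by (rule has_field_derivative_at_within, rule has_real_derivative_powr) (fact assms)
  then have "x powr t - a powr t \<ge> t * a powr (t - 1) * (x - a)"
    using assms False
    by (intro convex_on_imp_above_tangent[OF powr_convex[of t]]) (auto simp: interior_open)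
  then show ?thesis by simp
qed

text \<open>By the Poisson formula \<open>|F z|\<close> is at most the Poisson mean of
  \<open>|F|\<close>. Jensen's inequality is then the tangent inequality at \<open>a = |F z|\<close>
  integrated against the kernel, which has mean \<open>1\<close>; the linear term is nonnegative by
  the first bound.\<close>

lemma poisson_jensen:
  assumes G: "G holomorphic_on cball 0 1" and H: "H holomorphic_on cball 0 1" and z: "norm z < 1"
    and F: "\<And>w. norm w \<le> 1 \<Longrightarrow> F w = G w + cnj (H w)" and t: "t \<ge> 1"
  shows "ennreal (norm (F z) powr t) \<le>
    (\<integral>\<^sup>+\<theta>. ennreal (circle_weight \<theta>) * (ennreal (poisson z (cis \<theta>)) * ennreal (norm (F (cis \<theta>)) powr t)) \<partial>lborel)"
proof (cases "F z = 0")
  case False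
  define a where "a = norm (F z)"
  have a: "a > 0" using False by (simp add: a_def)
  let ?P = "\<lambda>\<theta>. poisson z (cis \<theta>)"
  have P0: "?P \<theta> \<ge> 0" for \<theta> using z by (intro poisson_nonneg) simp
  have "continuous_on (cball 0 1) (\<lambda>w. G w + cnj (H w))"
    by (intro continuous_intros holomorphic_on_imp_continuous_on G H)
  then have "continuous_on (cball 0 1) F" by (rule continuous_on_eq) (simp add: F)
  then have Fc: "continuous_on {0..2*pi} (\<lambda>\<theta>. F (cis \<theta>))"
    by (rule continuous_on_compose2) (auto intro!: continuous_intros)
  have Pc: "continuous_on {0..2*pi} ?P"
    unfolding poisson_def using z by (intro continuous_intros) auto
  have "(\<lambda>\<theta>. ?P \<theta> * norm (F (cis \<theta>))) integrable_on {0..2*pi}"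
    by (intro integrable_continuous_interval continuous_on_mult continuous_on_norm Fc Pc)
  then obtain I where I: "((\<lambda>\<theta>. ?P \<theta> * norm (F (cis \<theta>))) has_integral I) {0..2*pi}" by blast
  have "(\<lambda>\<theta>. ?P \<theta> * norm (F (cis \<theta>)) powr t) integrable_on {0..2*pi}"
    using t by (intro integrable_continuous_interval continuous_on_mult continuous_on_norm continuous_on_powr'
        continuous_on_const Fc Pc) auto
  then obtain J where J: "((\<lambda>\<theta>. ?P \<theta> * norm (F (cis \<theta>)) powr t) has_integral J) {0..2*pi}" by blast
  have "2 * pi * a \<le> I"
  proof -
    have *: "((\<lambda>\<theta>. ?P \<theta> * F (cis \<theta>)) has_integral 2 * pi * F z) {0..2*pi}"
      by (rule poisson_harmonic[OF G H z F])
    have "norm (integral {0..2*pi} (\<lambda>\<theta>. ?P \<theta> * F (cis \<theta>))) \<le> integral {0..2*pi} (\<lambda>\<theta>. ?P \<theta> * norm (F (cis \<theta>)))"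
      using * I P0 by (intro integral_norm_bound_integral) (auto simp: norm_mult)
    then have "norm (2 * pi * F z) \<le> I"
      using * I by (simp only: integral_unique)
    then show ?thesis by (simp add: a_def norm_mult)
  qed
  have "((\<lambda>\<theta>. (a powr t - t * a powr (t - 1) * a) * ?P \<theta> + t * a powr (t - 1) * (?P \<theta> * norm (F (cis \<theta>))))
      has_integral (a powr t - t * a powr (t - 1) * a) * (2 * pi) + t * a powr (t - 1) * I) {0..2*pi}"
    by (intro has_integral_add has_integral_mult_right I poisson_integral_1 z)
  moreover note J
  moreover have "(a powr t - t * a powr (t - 1) * a) * ?P \<theta> + t * a powr (t - 1) * (?P \<theta> * norm (F (cis \<theta>)))
      \<le> ?P \<theta> * norm (F (cis \<theta>)) powr t" for \<theta>
    using mult_left_mono[OF powr_above_tangent[OF a norm_ge_zero[of "F (cis \<theta>)"] t] P0[of \<theta>]]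
    by (simp add: algebra_simps)
  ultimately have "(a powr t - t * a powr (t - 1) * a) * (2 * pi) + t * a powr (t - 1) * I \<le> J"
    by (rule has_integral_le)
  moreover have "t * a powr (t - 1) * (2 * pi * a) \<le> t * a powr (t - 1) * I"
    using \<open>2 * pi * a \<le> I\<close> t by (intro mult_left_mono) auto
  ultimately have "2 * pi * a powr t \<le> J" by (simp add: algebra_simps)
  then have "a powr t \<le> J / (2 * pi)" by (simp add: field_simps)
  then have "ennreal (a powr t) \<le> ennreal (J / (2 * pi))" by (rule ennreal_leI)
  also have "\<dots> = (\<integral>\<^sup>+\<theta>. ennreal (circle_weight \<theta>) * ennreal (?P \<theta> * norm (F (cis \<theta>)) powr t) \<partial>lborel)"
    using J P0 by (intro nn_integral_circle_weight[symmetric]) auto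
  finally show ?thesis using P0 by (simp add: a_def ennreal_mult)
qed simp

section \<open>The closed polydisc and dilations\<close>

definition closed_polydisc :: "(complex ^ 'n) set" where
  "closed_polydisc = {z. \<forall>k. norm (z $ k) \<le> 1}"

lemma compact_closed_polydisc: "compact (closed_polydisc :: (complex ^ 'n::finite) set)"
proof -
  have eq: "closed_polydisc = (\<Inter>k. {z :: complex ^ 'n. norm (z $ k) \<le> 1})"
    by (auto simp: closed_polydisc_def)
  have "closed (closed_polydisc :: (complex ^ 'n) set)"
    unfolding eq by (intro closed_INT ballI closed_Collect_le continuous_intros)
  moreover have "norm z \<le> real CARD('n)" if "z \<in> closed_polydisc" for z :: "complex ^ 'n"
  proof -
    have "norm z \<le> (\<Sum>k\<in>UNIV. norm (z $ k))"
      unfolding norm_vec_def by (rule L2_set_le_sum) simp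
    also have "\<dots> \<le> (\<Sum>k\<in>(UNIV :: 'n set). 1)"
      using that by (intro sum_mono) (auto simp: closed_polydisc_def)
    finally show ?thesis by simp
  qed
  ultimately show ?thesis by (auto simp: compact_eq_bounded_closed bounded_iff)
qed

lemma polydisc_subset_closed: "polydisc \<subseteq> closed_polydisc" "torus \<subseteq> closed_polydisc"
  by (auto simp: polydisc_def torus_def closed_polydisc_def less_imp_le)

lemma pluriharmonic_continuous_on: "pluriharmonic f \<Longrightarrow> continuous_on polydisc f"
  unfolding pluriharmonic_def C2_on_def
  by (meson continuous_at_imp_continuous_on differentiable_imp_continuous_within)

text \<open>Continuity up to the boundary is what dilating buys: the dilated function is bounded and
  measurable on both the polydisc and the torus.\<close>

lemma pluriharmonic_dilation_continuous_on:
  fixes f :: "complex ^ 'n::finite \<Rightarrow> complex"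
  assumes f: "pluriharmonic f" and r: "0 < r" "r < 1"
  shows "continuous_on closed_polydisc (\<lambda>z. f (r *\<^sub>R z))"
proof (rule continuous_on_compose2[OF pluriharmonic_continuous_on[OF f]])
  show "(\<lambda>z. r *\<^sub>R z) ` closed_polydisc \<subseteq> (polydisc :: (complex ^ 'n) set)"
  proof (clarsimp simp: polydisc_def closed_polydisc_def)
    fix z :: "complex ^ 'n" and k
    assume "\<forall>k. norm (z $ k) \<le> 1"
    then have "r * norm (z $ k) \<le> r * 1" using r by (intro mult_left_mono) auto
    then have "r * norm (z $ k) < 1" using r by linarith
    then show "\<bar>r\<bar> * norm (z $ k) < 1" using r by simp
  qed
qed (intro continuous_intros)

lemma poisson_measurable [measurable]:
  "(\<lambda>(z, w). poisson z w) \<in> borel_measurable (borel \<Otimes>\<^sub>M borel)"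
  unfolding poisson_def by measurable

lemma poisson_jensen_slice:
  fixes f :: "complex ^ 'n::finite \<Rightarrow> complex" and z :: "complex ^ 'n"
  assumes f: "pluriharmonic f" and r: "0 < r" "r < 1" and t: "t \<ge> 1"
    and z: "z \<in> closed_polydisc" "norm (z $ k) < 1"
  shows "ennreal (norm (f (r *\<^sub>R z)) powr t) \<le>
    (\<integral>\<^sup>+\<theta>. ennreal (circle_weight \<theta>) * (ennreal (poisson (z $ k) (cis \<theta>)) *
        ennreal (norm (f (r *\<^sub>R vec_upd z k (cis \<theta>))) powr t)) \<partial>lborel)"
proof -
  have "norm (z $ i) \<le> 1" for i using z by (auto simp: closed_polydisc_def)
  from pluriharmonic_slice[OF f r this] obtain G H where GH: "G holomorphic_on cball 0 1" "H holomorphic_on cball 0 1"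
    "\<And>w. norm w \<le> 1 \<Longrightarrow> f (r *\<^sub>R vec_upd z k w) = G w + cnj (H w)" by metis
  have "vec_upd z k (z $ k) = z" by (simp add: vec_upd_def vec_eq_iff)
  with poisson_jensen[OF GH(1,2) z(2) GH(3) t] show ?thesis by simp
qed

text \<open>The one-variable inequality is applied to one coordinate after another, by induction on
  the set \<open>J\<close> of coordinates already moved to the circle. The intermediate points have
  coordinates on the circle as well as inside the disc, hence the closed polydisc in
  \<open>poisson_jensen_slice\<close>.\<close>

lemma polydisc_poisson_jensen:
  fixes f :: "complex ^ 'n::finite \<Rightarrow> complex" and z :: "complex ^ 'n"
  assumes f: "pluriharmonic f" and r: "0 < r" "r < 1" and t: "t \<ge> 1" and z: "z \<in> polydisc"
  shows "ennreal (norm (f (r *\<^sub>R z)) powr t) \<le>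
    (\<integral>\<^sup>+w. (\<Prod>k\<in>UNIV. ennreal (poisson (z $ k) (w $ k))) * ennreal (norm (f (r *\<^sub>R w)) powr t) \<partial>haar_torus)"
proof -
  interpret product_sigma_finite "\<lambda>_::'n. lborel :: real measure" by standard
  let ?u = "\<lambda>w. norm (f (r *\<^sub>R w)) powr t"
  \<comment> \<open>The cutoff makes \<open>U\<close> Borel on the whole space; every point at which
    it is evaluated below lies in the closed polydisc.\<close>
  define U where "U w = ennreal (indicator closed_polydisc w *\<^sub>R ?u w)" for w
  have uc: "continuous_on closed_polydisc ?u"
    using t by (intro continuous_on_powr' continuous_intros pluriharmonic_dilation_continuous_on f r) auto
  then have [measurable]: "U \<in> borel_measurable borel"
    unfolding U_def
    by (intro measurable_compose[OF _ measurable_ennreal] borel_measurable_continuous_on_indicator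
          borel_closed compact_imp_closed compact_closed_polydisc)
  define W where "W k \<theta> = ennreal (circle_weight \<theta>) * ennreal (poisson (z $ k) (cis \<theta>))" for k \<theta>
  have [measurable]: "W k \<in> borel_measurable borel" for k unfolding W_def by measurable
  define mix where "mix J x = (\<chi> k. if k \<in> J then cis (x k) else z $ k)" for J :: "'n set" and x
  have [measurable]: "mix J \<in> borel_measurable (Pi\<^sub>M J (\<lambda>_. lborel))" for J
    unfolding mix_def
  proof (rule borel_measurable_vec_lambda)
    show "(\<lambda>x. if k \<in> J then cis (x k) else z $ k) \<in> borel_measurable (Pi\<^sub>M J (\<lambda>_. lborel))" for k
      by (cases "k \<in> J") simp_all
  qed
  have mix: "mix J x \<in> closed_polydisc" for J x
    using z by (auto simp: mix_def closed_polydisc_def polydisc_def less_imp_le)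
  have "U z \<le> (\<integral>\<^sup>+x. (\<Prod>k\<in>J. W k (x k)) * U (mix J x) \<partial>Pi\<^sub>M J (\<lambda>_. lborel))" if "finite J" for J
    using that
  proof induction
    case empty
    have "mix {} x = z" for x by (simp add: mix_def)
    then show ?case by (simp add: PiM_empty)
  next
    case (insert i J)
    note insert.hyps(1)[simp]
    \<comment> \<open>Coordinate \<open>i\<close> of \<open>mix J x\<close> is still
      \<open>z $ i\<close>, strictly inside the disc, so it can be replaced by a Poisson mean over
      the circle.\<close>
    have "U (mix J x) \<le> (\<integral>\<^sup>+y. W i y * U (mix (insert i J) (x(i := y))) \<partial>lborel)" for x
    proof -
      have "mix J x $ i = z $ i" using insert.hyps by (simp add: mix_def)
      moreover have "norm (z $ i) < 1" using z by (simp add: polydisc_def)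
      moreover have "vec_upd (mix J x) i (cis y) = mix (insert i J) (x(i := y))" for y
        using insert.hyps by (auto simp: mix_def vec_upd_def vec_eq_iff)
      ultimately show ?thesis
        using poisson_jensen_slice[OF f r t mix[of J x], of i]
        by (simp add: U_def W_def mult.assoc mix)
    qed
    then have "(\<integral>\<^sup>+x. (\<Prod>k\<in>J. W k (x k)) * U (mix J x) \<partial>Pi\<^sub>M J (\<lambda>_. lborel)) \<le>
       (\<integral>\<^sup>+x. (\<Prod>k\<in>J. W k (x k)) * (\<integral>\<^sup>+y. W i y * U (mix (insert i J) (x(i := y))) \<partial>lborel) \<partial>Pi\<^sub>M J (\<lambda>_. lborel))"
      by (intro nn_integral_mono mult_left_mono) auto
    also have "\<dots> = (\<integral>\<^sup>+x. \<integral>\<^sup>+y. (\<Prod>k\<in>insert i J. W k ((x(i := y)) k)) * U (mix (insert i J) (x(i := y))) \<partial>lborel \<partial>Pi\<^sub>M J (\<lambda>_. lborel))"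
    proof (rule nn_integral_cong)
      fix x assume x: "x \<in> space (Pi\<^sub>M J (\<lambda>_. lborel :: real measure))"
      have [measurable]: "(\<lambda>y. x(i := y)) \<in> lborel \<rightarrow>\<^sub>M Pi\<^sub>M (insert i J) (\<lambda>_. lborel)"
        using x by simp
      have "(\<Prod>k\<in>insert i J. W k ((x(i := y)) k)) = (\<Prod>k\<in>J. W k (x k)) * W i y" for y
      proof -
        have "(\<Prod>k\<in>J. W k ((x(i := y)) k)) = (\<Prod>k\<in>J. W k (x k))"
          using insert.hyps by (intro prod.cong) auto
        then show ?thesis using insert.hyps by (simp add: mult.commute)
      qed
      then show "(\<Prod>k\<in>J. W k (x k)) * (\<integral>\<^sup>+y. W i y * U (mix (insert i J) (x(i := y))) \<partial>lborel) =
        (\<integral>\<^sup>+y. (\<Prod>k\<in>insert i J. W k ((x(i := y)) k)) * U (mix (insert i J) (x(i := y))) \<partial>lborel)"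
        by (simp only: mult.assoc) (rule nn_integral_cmult[symmetric], measurable)
    qed
    also have "\<dots> = (\<integral>\<^sup>+x. (\<Prod>k\<in>insert i J. W k (x k)) * U (mix (insert i J) x) \<partial>Pi\<^sub>M (insert i J) (\<lambda>_. lborel))"
      using insert.hyps by (intro product_nn_integral_insert[symmetric]) measurable
    finally show ?case using insert.IH by (rule order_trans[rotated])
  qed
  from this[of UNIV] have "U z \<le> (\<integral>\<^sup>+x. (\<Prod>k\<in>UNIV. W k (x k)) * U (mix UNIV x) \<partial>Pi\<^sub>M UNIV (\<lambda>_. lborel))"
    by simp
  also have "\<dots> = (\<integral>\<^sup>+\<theta>. (\<Prod>k\<in>UNIV. W k (\<theta> $ k)) * U (torus_param \<theta>) \<partial>(lborel :: (real ^ 'n) measure))"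
  proof -
      show ?thesis by (subst nn_integral_lborel_vec, measurable) (simp add: mix_def torus_param_def)
  qed
  also have "\<dots> = (\<integral>\<^sup>+w. (\<Prod>k\<in>UNIV. ennreal (poisson (z $ k) (w $ k))) * ennreal (?u w) \<partial>haar_torus)"
  proof (subst nn_integral_haar_torus)
    have "continuous_on torus ?u" using uc polydisc_subset_closed(2) by (rule continuous_on_subset)
    then have [measurable]: "?u \<in> borel_measurable (restrict_space borel torus)"
      by (rule borel_measurable_continuous_on_restrict)
      have [measurable]: "(\<lambda>w. \<Prod>k\<in>UNIV. ennreal (poisson (z $ k) (w $ k))) \<in> borel_measurable (restrict_space borel torus)"
      by (intro measurable_restrict_space1) measurable
    show "(\<lambda>w. (\<Prod>k\<in>UNIV. ennreal (poisson (z $ k) (w $ k))) * ennreal (?u w)) \<in> borel_measurable (restrict_space borel torus)"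
      by measurable
    have "torus_param \<theta> \<in> closed_polydisc" for \<theta> :: "real ^ 'n"
      using polydisc_subset_closed(2) torus_param_torus by blast
    then show "(\<integral>\<^sup>+\<theta>. (\<Prod>k\<in>UNIV. W k (\<theta> $ k)) * U (torus_param \<theta>) \<partial>lborel) =
      (\<integral>\<^sup>+\<theta>. (\<Prod>k\<in>UNIV. ennreal (circle_weight (\<theta> $ k))) *
        ((\<Prod>k\<in>UNIV. ennreal (poisson (z $ k) (torus_param \<theta> $ k))) * ennreal (?u (torus_param \<theta>))) \<partial>lborel)"
      by (simp add: U_def W_def prod.distrib torus_param_def mult.assoc)
  qed
  finally show ?thesis using z polydisc_subset_closed(1) by (auto simp: U_def)
qed

section \<open>The Hardy--Bergman inequality\<close>

lemma measurable_id_bergman_measure [measurable]: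
  "(\<lambda>z::complex ^ 'n::finite. z) \<in> bergman_measure m \<rightarrow>\<^sub>M borel"
  by (simp add: measurable_cong_sets[OF sets_bergman_measure refl] measurable_restrict_space1)

lemma measurable_id_haar_torus [measurable]:
  "(\<lambda>z::complex ^ 'n::finite. z) \<in> haar_torus \<rightarrow>\<^sub>M borel"
  by (simp add: measurable_cong_sets[OF sets_haar_torus refl] measurable_restrict_space1)

lemma disc_schur_const_pos: "m \<ge> 2 \<Longrightarrow> disc_schur_const m > 0"
  by (simp add: disc_schur_const_def)

text \<open>Provides the hypothesis \<open>PK\<close>: the integral factors over the coordinates,
  and each factor is computed by \<open>poisson_kernel_product\<close> and bounded by
  \<open>Re_cayley_le\<close>.\<close>

lemma haar_torus_poisson_kernel:
  fixes z \<zeta> :: "complex ^ 'n::finite"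
  assumes "z \<in> polydisc" "\<zeta> \<in> polydisc"
  shows "(\<integral>\<^sup>+w. (\<Prod>k\<in>UNIV. ennreal (poisson (z $ k) (w $ k))) * (\<Prod>k\<in>UNIV. ennreal (poisson (\<zeta> $ k) (w $ k))) \<partial>haar_torus)
    \<le> (\<Prod>k\<in>UNIV. ennreal (disc_kernel (z $ k) (\<zeta> $ k)))"
proof -
  have nz: "norm (z $ k) < 1" "norm (\<zeta> $ k) < 1" for k using assms by (auto simp: polydisc_def)
  have "(\<integral>\<^sup>+w. (\<Prod>k\<in>UNIV. ennreal (poisson (z $ k) (w $ k))) * (\<Prod>k\<in>UNIV. ennreal (poisson (\<zeta> $ k) (w $ k))) \<partial>haar_torus)
    = (\<Prod>k\<in>UNIV. \<integral>\<^sup>+t. ennreal (circle_weight t) * (ennreal (poisson (z $ k) (cis t)) * ennreal (poisson (\<zeta> $ k) (cis t))) \<partial>lborel)"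
    unfolding prod.distrib[symmetric] by (rule nn_integral_haar_torus_prod) measurable
  also have "\<dots> \<le> (\<Prod>k\<in>UNIV. ennreal (disc_kernel (z $ k) (\<zeta> $ k)))"
  proof (rule prod_mono_ennreal)
    fix k
    have P0: "poisson (z $ k) w \<ge> 0" "poisson (\<zeta> $ k) w \<ge> 0" for w
      using nz[of k] by (auto intro!: poisson_nonneg)
    have "(\<integral>\<^sup>+t. ennreal (circle_weight t) * ennreal (poisson (z $ k) (cis t) * poisson (\<zeta> $ k) (cis t)) \<partial>lborel)
        = ennreal (Re ((1 + cnj (\<zeta> $ k) * z $ k) / (1 - cnj (\<zeta> $ k) * z $ k)))"
      by (rule nn_integral_circle_weight[OF _ poisson_kernel_product]) (use P0 nz in auto)
    also have "\<dots> \<le> ennreal (disc_kernel (z $ k) (\<zeta> $ k))"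
      unfolding disc_kernel_def by (intro ennreal_leI Re_cayley_le nz)
    finally show "(\<integral>\<^sup>+t. ennreal (circle_weight t) * (ennreal (poisson (z $ k) (cis t)) * ennreal (poisson (\<zeta> $ k) (cis t))) \<partial>lborel)
        \<le> ennreal (disc_kernel (z $ k) (\<zeta> $ k))"
      using P0 by (simp add: ennreal_mult)
  qed
  finally show ?thesis .
qed

definition schur_weight :: "complex ^ 'n::finite \<Rightarrow> ennreal" where
  "schur_weight z = (\<Prod>k\<in>UNIV. ennreal (1 / sqrt (1 - (norm (z $ k))\<^sup>2)))"

lemma schur_weight_measurable [measurable]: "schur_weight \<in> borel_measurable borel"
  unfolding schur_weight_def[abs_def] by measurable

text \<open>Provides the hypothesis \<open>Kh\<close>: kernel, test function and measure are
  products, so the estimate in the disc is applied in each variable.\<close>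

lemma polydisc_schur:
  fixes z :: "complex ^ 'n::finite"
  assumes z: "z \<in> polydisc" and m: "m \<ge> 2"
  shows "(\<integral>\<^sup>+\<zeta>. (\<Prod>k\<in>UNIV. ennreal (disc_kernel (z $ k) (\<zeta> $ k))) ^ m * schur_weight \<zeta> \<partial>bergman_measure m)
    \<le> ennreal (disc_schur_const m) ^ CARD('n) * schur_weight z"
proof -
  let ?g = "\<lambda>k \<zeta>. ennreal (disc_kernel (z $ k) \<zeta>) ^ m * ennreal (1 / sqrt (1 - (norm \<zeta>)\<^sup>2))"
  have "(\<integral>\<^sup>+\<zeta>. (\<Prod>k\<in>UNIV. ennreal (disc_kernel (z $ k) (\<zeta> $ k))) ^ m * schur_weight \<zeta> \<partial>bergman_measure m)
     = (\<integral>\<^sup>+\<zeta>. (\<Prod>k\<in>UNIV. ?g k (\<zeta> $ k)) \<partial>bergman_measure m)"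
    by (simp add: schur_weight_def prod.distrib prod_power_distrib)
  also have "\<dots> = (\<Prod>k\<in>UNIV. \<integral>\<^sup>+\<zeta>. ennreal (disc_weight m \<zeta>) * ?g k \<zeta> \<partial>lborel)"
    by (rule nn_integral_bergman_measure_prod[OF m]) measurable
  also have "\<dots> \<le> (\<Prod>k\<in>UNIV. ennreal (disc_schur_const m) * ennreal (1 / sqrt (1 - (norm (z $ k))\<^sup>2)))"
  proof (rule prod_mono_ennreal)
    fix k
    have "ennreal (disc_weight m \<zeta>) * ?g k \<zeta>
        = ennreal (disc_weight m \<zeta> * (disc_kernel (z $ k) \<zeta> ^ m / sqrt (1 - (norm \<zeta>)\<^sup>2)))" for \<zeta>
    proof -
      have "?g k \<zeta> = ennreal (disc_kernel (z $ k) \<zeta> ^ m * (1 / sqrt (1 - (norm \<zeta>)\<^sup>2)))"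
        by (subst ennreal_mult') (simp_all add: disc_kernel_nonneg ennreal_power)
      then show ?thesis
        using m by (subst ennreal_mult'[of "disc_weight m \<zeta>"]) (simp_all add: disc_weight_nonneg)
    qed
    moreover have "norm (z $ k) < 1" using z by (simp add: polydisc_def)
    note disc_schur[OF this m]
    moreover have "ennreal (disc_schur_const m / sqrt (1 - (norm (z $ k))\<^sup>2))
       = ennreal (disc_schur_const m) * ennreal (1 / sqrt (1 - (norm (z $ k))\<^sup>2))"
      using disc_schur_const_pos[OF m] by (subst ennreal_mult'[symmetric]) auto
    ultimately show "(\<integral>\<^sup>+\<zeta>. ennreal (disc_weight m \<zeta>) * ?g k \<zeta> \<partial>lborel)
        \<le> ennreal (disc_schur_const m) * ennreal (1 / sqrt (1 - (norm (z $ k))\<^sup>2))"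
      by simp
  qed
  also have "\<dots> = ennreal (disc_schur_const m) ^ CARD('n) * schur_weight z"
    by (simp add: schur_weight_def prod.distrib)
  finally show ?thesis .
qed

text \<open>The factor \<open>2 ^ Suc m\<close> comes from \<open>schur_TT_star\<close>, the other
  one from \<open>polydisc_schur\<close>. No exponent \<open>p\<close> enters, and this is what
  makes the limit \<open>1\<close>.\<close>

definition hardy_bergman_const :: "'n::finite itself \<Rightarrow> nat \<Rightarrow> real" where
  "hardy_bergman_const _ m = 2 ^ Suc m * disc_schur_const m ^ CARD('n)"

lemma hardy_bergman_const_pos: "m \<ge> 2 \<Longrightarrow> hardy_bergman_const N m > 0"
  by (simp add: hardy_bergman_const_def disc_schur_const_pos)

lemma nn_integral_bounded_finite:
  assumes "emeasure M (space M) = 1" "\<And>x. x \<in> space M \<Longrightarrow> f x \<le> ennreal B"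
  shows "(\<integral>\<^sup>+x. f x \<partial>M) < \<infinity>"
proof -
  have "(\<integral>\<^sup>+x. f x \<partial>M) \<le> (\<integral>\<^sup>+x. ennreal B \<partial>M)" using assms by (intro nn_integral_mono) auto
  also have "\<dots> < \<infinity>" using assms by simp
  finally show ?thesis .
qed

text \<open>This is \<open>schur_TT_star\<close> with \<open>v = u\<close>. The assumption
  \<open>p >= 2\<close> makes the exponent \<open>p / 2\<close> at least \<open>1\<close>, as
  Jensen's inequality requires; the dilation makes \<open>u\<close> bounded, so the integrals are
  finite before any estimate.\<close>

lemma bergman_hardy_dilation:
  fixes f :: "complex ^ 'n::finite \<Rightarrow> complex"
  assumes f: "pluriharmonic f" and r: "0 < r" "r < 1" and p: "p \<ge> 2" and m: "m \<ge> 2"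
  shows "(\<integral>\<^sup>+z. ennreal (norm (f (r *\<^sub>R z)) powr (real m * p)) \<partial>bergman_measure m)
    \<le> ennreal (hardy_bergman_const TYPE('n) m) * (\<integral>\<^sup>+w. ennreal (norm (f (r *\<^sub>R w)) powr p) \<partial>haar_torus) ^ m"
    and "(\<integral>\<^sup>+w. ennreal (norm (f (r *\<^sub>R w)) powr p) \<partial>(haar_torus :: (complex ^ 'n) measure)) < \<infinity>"
proof -
  let ?M = "bergman_measure m :: (complex ^ 'n) measure" and ?T = "haar_torus :: (complex ^ 'n) measure"
  define u where "u z = ennreal (norm (f (r *\<^sub>R z)) powr (p / 2))" for z
  have uc: "continuous_on closed_polydisc (\<lambda>z. norm (f (r *\<^sub>R z)) powr (p / 2))"
    using p by (intro continuous_on_powr' continuous_intros pluriharmonic_dilation_continuous_on f r) auto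
  have um: "u \<in> borel_measurable (restrict_space borel S)" if "S \<subseteq> closed_polydisc" for S
    unfolding u_def
    by (intro measurable_compose[OF _ measurable_ennreal] borel_measurable_continuous_on_restrict
          continuous_on_subset[OF uc that])
  have u[measurable]: "u \<in> borel_measurable ?M" "u \<in> borel_measurable ?T"
    using um polydisc_subset_closed
    by (simp_all add: measurable_cong_sets[OF sets_bergman_measure refl] measurable_cong_sets[OF sets_haar_torus refl])
  \<comment> \<open>The condition \<open>j >= 1\<close> matters at zeros of \<open>f\<close>, where
    \<open>0 powr 0 = 0\<close> but a zeroth power is \<open>1\<close>.\<close>
  have upow: "u z ^ (2 * j) = ennreal (norm (f (r *\<^sub>R z)) powr (real j * p))" if "j \<ge> 1" for z j
  proof -
    have "(norm (f (r *\<^sub>R z)) powr (p / 2)) ^ (2 * j) = norm (f (r *\<^sub>R z)) powr (real j * p)"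
    proof (cases "f (r *\<^sub>R z) = 0")
      case False
      then show ?thesis by (simp add: powr_power mult.commute)
    qed (use that p in simp)
    then show ?thesis by (simp add: u_def ennreal_power)
  qed
  obtain B where B: "\<And>z. z \<in> closed_polydisc \<Longrightarrow> norm (f (r *\<^sub>R z)) powr (p / 2) \<le> B"
    using continuous_attains_sup[OF compact_closed_polydisc _ uc]
    by (metis empty_iff)
  have bound: "u z ^ j \<le> ennreal (B ^ j)" if "z \<in> closed_polydisc" for z j
    using B[OF that] by (auto simp: u_def ennreal_power intro!: ennreal_leI power_mono)
  have mass: "emeasure ?M (space ?M) = 1" "emeasure ?T (space ?T) = 1"
    using emeasure_bergman_measure_polydisc[OF m] emeasure_haar_torus by simp_all
  have A: "(\<integral>\<^sup>+z. u z ^ (2 * m) \<partial>?M) < \<infinity>"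
    by (rule nn_integral_bounded_finite[OF mass(1)], rule bound) (use polydisc_subset_closed(1) in auto)
  have S: "(\<integral>\<^sup>+w. (u w)\<^sup>2 \<partial>?T) < \<infinity>"
    by (rule nn_integral_bounded_finite[OF mass(2)], rule bound) (use polydisc_subset_closed(2) in auto)
  have sf: "sigma_finite_measure ?M" "sigma_finite_measure ?T"
    using mass by (auto intro!: finite_measure.axioms(1) finite_measureI)
  have Pm: "(\<lambda>(z, w). \<Prod>k\<in>UNIV. ennreal (poisson (z $ k) (w $ k))) \<in> borel_measurable (?M \<Otimes>\<^sub>M ?T)"
    by measurable
  have Km: "(\<lambda>(z, w). \<Prod>k\<in>UNIV. ennreal (disc_kernel (z $ k) (w $ k))) \<in> borel_measurable (?M \<Otimes>\<^sub>M ?M)"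
    by measurable
  have hm: "schur_weight \<in> borel_measurable ?M" by measurable
  have h: "schur_weight z \<noteq> 0 \<and> schur_weight z \<noteq> \<infinity>" if "z \<in> space ?M" for z
  proof -
    have "norm (z $ k) < 1" for k using that by (auto simp: polydisc_def)
    then have "sqrt (1 - (norm (z $ k))\<^sup>2) > 0" for k by (simp add: power_less_one_iff)
    then have "(\<Prod>k\<in>UNIV. 1 / sqrt (1 - (norm (z $ k))\<^sup>2)) > 0" by (intro prod_pos) simp
    moreover have "schur_weight z = ennreal (\<Prod>k\<in>UNIV. 1 / sqrt (1 - (norm (z $ k))\<^sup>2))"
      unfolding schur_weight_def using \<open>\<And>k. sqrt (1 - (norm (z $ k))\<^sup>2) > 0\<close>
      by (intro prod_ennreal) (simp add: less_imp_le)
    ultimately show ?thesis by (metis ennreal_eq_0_iff ennreal_neq_top infinity_ennreal_def not_le)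
  qed
  have uP: "u z \<le> (\<integral>\<^sup>+w. (\<Prod>k\<in>UNIV. ennreal (poisson (z $ k) (w $ k))) * u w \<partial>?T)" if "z \<in> space ?M" for z
    using polydisc_poisson_jensen[OF f r, of "p / 2" z] p that by (simp add: u_def)
  have K: "(\<Prod>k\<in>UNIV. ennreal (disc_kernel (z $ k) (\<zeta> $ k))) = (\<Prod>k\<in>UNIV. ennreal (disc_kernel (\<zeta> $ k) (z $ k)))"
    for z \<zeta> :: "complex ^ 'n"
    by (simp add: disc_kernel_commute)
  have Cfin: "ennreal (disc_schur_const m) ^ CARD('n) < \<infinity>"
    using disc_schur_const_pos[OF m] by (simp add: ennreal_power)
  have "(\<integral>\<^sup>+z. u z ^ (2 * m) \<partial>?M) \<le> 2 ^ Suc m * ennreal (disc_schur_const m) ^ CARD('n) * (\<integral>\<^sup>+w. (u w)\<^sup>2 \<partial>?T) ^ m"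
    by (rule schur_TT_star[where P = "\<lambda>z w. \<Prod>k\<in>UNIV. ennreal (poisson (z $ k) (w $ k))"
          and K = "\<lambda>z w. \<Prod>k\<in>UNIV. ennreal (disc_kernel (z $ k) (w $ k))" and h = schur_weight,
          OF sf Pm Km hm u h K uP _ _ _ A S])
      (use m haar_torus_poisson_kernel polydisc_schur Cfin in auto)
  also have "2 ^ Suc m * ennreal (disc_schur_const m) ^ CARD('n) = ennreal (hardy_bergman_const TYPE('n) m)"
    using disc_schur_const_pos[OF m]
    by (simp add: hardy_bergman_const_def ennreal_power ennreal_mult flip: ennreal_numeral)
  finally show "(\<integral>\<^sup>+z. ennreal (norm (f (r *\<^sub>R z)) powr (real m * p)) \<partial>bergman_measure m)
    \<le> ennreal (hardy_bergman_const TYPE('n) m) * (\<integral>\<^sup>+w. ennreal (norm (f (r *\<^sub>R w)) powr p) \<partial>haar_torus) ^ m"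
    using upow[of m] upow[of 1] m by simp
  show "(\<integral>\<^sup>+w. ennreal (norm (f (r *\<^sub>R w)) powr p) \<partial>?T) < \<infinity>"
    using S upow[of 1] by simp
qed

text \<open>The estimate for dilations becomes uniform in \<open>r\<close> once the torus integral
  is bounded by \<open>N powr p\<close>. Fatou's lemma passes to \<open>f\<close> itself, and the
  root of order \<open>m * p\<close> is taken at the end.\<close>

lemma bergman_norm_le_hardy_norm:
  fixes f :: "complex ^ 'n::finite \<Rightarrow> complex"
  assumes f: "f \<in> hardy_space p" and p: "p \<ge> 2" and m: "m \<ge> 2"
  shows "bergman_norm m (real m * p) f \<le>
    ennreal (hardy_bergman_const TYPE('n) m powr (1 / (real m * p))) * hardy_norm p f"
proof -
  define c where "c = hardy_bergman_const TYPE('n) m"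
  have c: "c > 0" unfolding c_def by (rule hardy_bergman_const_pos[OF m])
  have ph: "pluriharmonic f" and fin: "hardy_norm p f < \<infinity>" using f by (auto simp: hardy_space_def)
  obtain N where N: "hardy_norm p f = ennreal N" "N \<ge> 0" using fin by (cases "hardy_norm p f") auto
  define q where "q = real m * p"
  have q: "q > 0" using m p by (simp add: q_def)
  have bound: "(\<integral>\<^sup>+z. ennreal (norm (f (r *\<^sub>R z)) powr q) \<partial>bergman_measure m) \<le> ennreal (c * N powr q)"
    if r: "0 < r" "r < 1" for r
  proof -
    define I where "I = enn2real (\<integral>\<^sup>+w. ennreal (norm (f (r *\<^sub>R w)) powr p) \<partial>(haar_torus :: (complex ^ 'n) measure))"
    have I: "(\<integral>\<^sup>+w. ennreal (norm (f (r *\<^sub>R w)) powr p) \<partial>(haar_torus :: (complex ^ 'n) measure)) = ennreal I" "I \<ge> 0"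
      using bergman_hardy_dilation(2)[OF ph r p m] by (auto simp: I_def less_top)
    have "Lp_norm p haar_torus (\<lambda>w. f (r *\<^sub>R w)) \<le> hardy_norm p f"
      unfolding hardy_norm_def using r by (intro SUP_upper) auto
    then have "I powr (1 / p) \<le> N"
      using I N by (simp add: Lp_norm_def ennreal_powr_def)
    then have "(I powr (1 / p)) powr p \<le> N powr p"
      using p by (intro powr_mono2) auto
    then have "I \<le> N powr p" using I p by (simp add: powr_powr)
    then have "I ^ m \<le> (N powr p) ^ m" using I by (intro power_mono)
    also have "\<dots> = N powr q"
    proof (cases "N = 0")
      case False
      then show ?thesis by (simp add: powr_power q_def mult.commute)
    qed (use m in simp)
    finally have "c * I ^ m \<le> c * N powr q" using c by simp
    moreover have "(\<integral>\<^sup>+z. ennreal (norm (f (r *\<^sub>R z)) powr q) \<partial>bergman_measure m) \<le> ennreal (c * I ^ m)"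
      using bergman_hardy_dilation(1)[OF ph r p m] c I
      by (simp add: c_def q_def ennreal_mult' ennreal_power)
    ultimately show ?thesis by (meson ennreal_leI order_trans)
  qed
  \<comment> \<open>Radii tending to \<open>1\<close> from below; the shift by \<open>2\<close>
    keeps the radius for \<open>n = 0\<close> positive.\<close>
  define \<rho> where "\<rho> n = 1 - 1 / (real n + 2)" for n
  have \<rho>: "0 < \<rho> n" "\<rho> n < 1" for n by (auto simp: \<rho>_def field_simps)
  have \<rho>lim: "\<rho> \<longlonglongrightarrow> 1" unfolding \<rho>_def by real_asymp
  have cont: "continuous_on polydisc f" using ph by (rule pluriharmonic_continuous_on)
  \<comment> \<open>Each value of \<open>f\<close> in the polydisc is the limit of the values of its
    dilations by continuity, written as a \<open>liminf\<close> for Fatou's lemma.\<close>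
  have "(\<integral>\<^sup>+z. ennreal (norm (f z) powr q) \<partial>bergman_measure m)
      = (\<integral>\<^sup>+z. liminf (\<lambda>n. ennreal (norm (f (\<rho> n *\<^sub>R z)) powr q)) \<partial>bergman_measure m)"
  proof (rule nn_integral_cong)
    fix z :: "complex ^ 'n" assume "z \<in> space (bergman_measure m)"
    then have z: "z \<in> polydisc" by simp
    have "isCont f z" using cont z open_polydisc by (metis continuous_on_eq_continuous_at)
    moreover have "(\<lambda>n. \<rho> n *\<^sub>R z) \<longlonglongrightarrow> z"
      using tendsto_scaleR[OF \<rho>lim tendsto_const[of z]] by simp
    ultimately have "(\<lambda>n. f (\<rho> n *\<^sub>R z)) \<longlonglongrightarrow> f z" by (rule isCont_tendsto_compose)
    then have "(\<lambda>n. ennreal (norm (f (\<rho> n *\<^sub>R z)) powr q)) \<longlonglongrightarrow> ennreal (norm (f z) powr q)"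
      using q by (intro tendsto_ennrealI tendsto_powr' tendsto_norm tendsto_const) auto
    from lim_imp_Liminf[OF sequentially_bot this]
    show "ennreal (norm (f z) powr q) = liminf (\<lambda>n. ennreal (norm (f (\<rho> n *\<^sub>R z)) powr q))" by simp
  qed
  also have "\<dots> \<le> liminf (\<lambda>n. \<integral>\<^sup>+z. ennreal (norm (f (\<rho> n *\<^sub>R z)) powr q) \<partial>bergman_measure m)"
  proof (rule nn_integral_liminf)
    fix n
    have "continuous_on polydisc (\<lambda>z. norm (f (\<rho> n *\<^sub>R z)) powr q)"
      using q by (intro continuous_on_powr' continuous_intros
          continuous_on_subset[OF pluriharmonic_dilation_continuous_on[OF ph \<rho>] polydisc_subset_closed(1)]) auto
    then show "(\<lambda>z. ennreal (norm (f (\<rho> n *\<^sub>R z)) powr q)) \<in> borel_measurable (bergman_measure m)"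
      by (simp add: measurable_cong_sets[OF sets_bergman_measure refl] borel_measurable_continuous_on_restrict)
  qed
  also have "\<dots> \<le> liminf (\<lambda>n::nat. ennreal (c * N powr q))"
    by (intro Liminf_mono always_eventually allI bound \<rho>)
  also have "\<dots> = ennreal (c * N powr q)" by (simp add: Liminf_const)
  finally have le: "(\<integral>\<^sup>+z. ennreal (norm (f z) powr q) \<partial>bergman_measure m) \<le> ennreal (c * N powr q)" .
  \<comment> \<open>\<open>enn2real\<close> sends infinity to \<open>0\<close>, so finiteness must
    be known before the root is taken among the reals.\<close>
  then have finI: "(\<integral>\<^sup>+z. ennreal (norm (f z) powr q) \<partial>bergman_measure m) \<noteq> \<infinity>"
    by (metis ennreal_neq_top infinity_ennreal_def top.extremum_uniqueI)
  have "enn2real (\<integral>\<^sup>+z. ennreal (norm (f z) powr q) \<partial>bergman_measure m) \<le> c * N powr q"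
    using le c by (intro enn2real_leI) auto
  then have "enn2real (\<integral>\<^sup>+z. ennreal (norm (f z) powr q) \<partial>bergman_measure m) powr (1 / q) \<le> (c * N powr q) powr (1 / q)"
    using q by (intro powr_mono2) auto
  also have "\<dots> = c powr (1 / q) * N" using c q N by (simp add: powr_mult powr_powr)
  finally have "bergman_norm m q f \<le> ennreal (c powr (1 / q) * N)"
    using finI by (simp add: bergman_norm_def Lp_norm_def ennreal_powr_def ennreal_leI)
  then show ?thesis using N by (simp add: q_def c_def ennreal_mult')
qed

section \<open>The lower bound and the limit\<close>

lemma one_in_hardy_space:
  "(\<lambda>_. 1) \<in> (hardy_space p :: (complex ^ 'n::finite \<Rightarrow> complex) set)"
  "hardy_norm p (\<lambda>_::complex ^ 'n. 1) = 1"
proof -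
  have "emeasure (haar_torus :: (complex ^ 'n) measure) (space haar_torus) = 1"
    by (simp add: emeasure_haar_torus)
  then show *: "hardy_norm p (\<lambda>_::complex ^ 'n. 1) = 1"
    by (simp add: hardy_norm_def Lp_norm_def ennreal_powr_def)
  have [simp]: "frechet_derivative (\<lambda>_. c) (at x) = (\<lambda>_. 0)" for c :: complex and x :: "complex ^ 'n"
    by (rule frechet_derivative_const)
  have "wirtinger_bar k (\<lambda>_::complex ^ 'n. 1) = (\<lambda>_. 0)" for k
    by (simp add: fun_eq_iff wirtinger_bar_def)
  then have "pluriharmonic (\<lambda>_::complex ^ 'n. 1)"
    by (simp add: pluriharmonic_def C2_on_def wirtinger_def)
  with * show "(\<lambda>_. 1) \<in> (hardy_space p :: (complex ^ 'n \<Rightarrow> complex) set)"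
    by (simp add: hardy_space_def)
qed

lemma best_constant_ge_1:
  assumes m: "m \<ge> 2"
  shows "1 \<le> best_constant TYPE('n::finite) p m"
  unfolding best_constant_def
proof (rule Inf_greatest)
  fix C assume C: "C \<in> admissible_constants TYPE('n) p m"
  have "emeasure (bergman_measure m :: (complex ^ 'n) measure) (space (bergman_measure m)) = 1"
    by (simp add: emeasure_bergman_measure_polydisc m)
  then have "bergman_norm m (real m * p) (\<lambda>_::complex ^ 'n. 1) = 1"
    by (simp add: bergman_norm_def Lp_norm_def ennreal_powr_def)
  moreover have "bergman_norm m (real m * p) (\<lambda>_::complex ^ 'n. 1) \<le> C * hardy_norm p (\<lambda>_::complex ^ 'n. 1)"
    using C one_in_hardy_space(1) by (auto simp: admissible_constants_def)
  ultimately show "1 \<le> C" by (simp add: one_in_hardy_space(2))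
qed

theorem corollary4p8:
  fixes m :: nat
  assumes "m \<ge> 2"
  shows "((\<lambda>p::real. best_constant TYPE('n::finite) p m) \<longlongrightarrow> 1) at_top"
proof (rule tendsto_sandwich)
  let ?c = "hardy_bergman_const TYPE('n) m"
  show "\<forall>\<^sub>F p in at_top. (1::ennreal) \<le> best_constant TYPE('n) p m"
    by (intro always_eventually allI best_constant_ge_1 assms)
  \<comment> \<open>The upper bound is available from \<open>p = 2\<close> on, which suffices for a
    limit at infinity.\<close>
  show "\<forall>\<^sub>F p in at_top. best_constant TYPE('n) p m \<le> ennreal (?c powr (1 / (real m * p)))"
    using eventually_ge_at_top[of 2]
  proof eventually_elim
    case (elim p)
    then show ?case
      unfolding best_constant_def admissible_constants_def
      using bergman_norm_le_hardy_norm[OF _ elim assms] by (intro Inf_lower) auto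
  qed
  have "((\<lambda>p. 1 / (real m * p)) \<longlongrightarrow> 0) at_top" using assms by real_asymp
  \<comment> \<open>Continuity of the power in its exponent uses that the base is positive.\<close>
  then have "((\<lambda>p. ?c powr (1 / (real m * p))) \<longlongrightarrow> ?c powr 0) at_top"
    using hardy_bergman_const_pos[OF assms, where N = "TYPE('n)"] by (intro tendsto_powr tendsto_const) auto
  then have "((\<lambda>p. ?c powr (1 / (real m * p))) \<longlongrightarrow> 1) at_top"
    using hardy_bergman_const_pos[OF assms, where N = "TYPE('n)"] by simp
  from tendsto_ennrealI[OF this]
  show "((\<lambda>p. ennreal (?c powr (1 / (real m * p)))) \<longlongrightarrow> 1) at_top" by simp
qed simp

end
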